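(* Let $P>0$ be fixed and let $\overline{\mathcal T}_2=\overline{\mathcal T}_2(K)$ be the throughput, with $K$ users, of Strategy II (SNR-based scheduling with adaptive codeword length), as defined in the context. Then, as $K\to\infty$, $$\overline{\mathcal T}_2 = \log\left(\frac{P\log K}{2}\right)-2\,(1+o(1))\,\mathbb{E}\left\{\sqrt{\log(\alpha^{-1})}\right\}\sqrt{\log\log\left(\frac{P\log K}{2}\right)},$$ where $\alpha$ is uniformly distributed on $(0,1)$.
   Context: **Channel.** There are $K$ users. User $k$ has a correlation coefficient $\alpha_k$ and an initial fading gain $u_{0,k}$; the $\alpha_k$ are i.i.d. uniform on $(0,1)$, the $u_{0,k}$ are i.i.d. with Rayleigh density $2ue^{-u^2}$, $u\ge0$, and the two families are independent. For a user with parameters $(u_0,\alpha)$, conditioned on these, the gains $u_1,u_2,\dots$ form a Markov chain started at $u_0$ with transition density, for $u\ge 0$, $$q(u\mid v)=\frac{2u}{1-\alpha^2}\exp\left(-\frac{u^2+\alpha^2v^2}{1-\alpha^2}\right)\mathcal{I}_0\left(\frac{2\alpha uv}{1-\alpha^2}\right),$$ with $\mathcal I_0$ the modified Bessel function of order zero. **Throughput of one user.** For codeword length $N$ and $\rho\in[0,1]$ let $$E_N(\rho;u_0,\alpha)=-\frac1N\log\mathbb{E}\left\{\prod_{i=1}^N\left(\frac{1}{1+\frac{P}{1+\rho}u_i^2}\right)^{\rho}\ \Big|\ u_0,\alpha\right\}$$ (random coding error exponent). For rate $R\ge0$ (nats per channel use) the throughput, with the frame error probability evaluated by its random coding upper bound,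 is $$T(u_0,\alpha;N,R)=R\left(1-\inf_{0\le\rho\le1}e^{-N(E_N(\rho;u_0,\alpha)-\rho R)}\right).$$ **Strategy II.** The base station transmits to the user $k^*=\arg\max_{1\le k\le K}u_{0,k}$, and both the rate and the codeword length are adapted to the selected user's parameters to maximize its throughput. Thus $$\overline{\mathcal T}_2(K)=\mathbb{E}\left\{\sup_{N\ge 1,\ R\ge0}T(u_{0,k^*},\alpha_{k^*};N,R)\right\}.$$ $\log$ is the natural logarithm. *)

theory Defs
  imports "HOL-Probability.Probability" "HOL-Library.Landau_Symbols"
begin

text \<open>Modified Bessel function of the first kind of order zero, by its (everywhere convergent)
  power series.\<close>

definition bessel_I0 :: "real \<Rightarrow> real" where
  "bessel_I0 x = (\<Sum>m. (x / 2) ^ (2 * m) / (fact m)\<^sup>2)"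

definition trans_density :: "real \<Rightarrow> real \<Rightarrow> real \<Rightarrow> real" where
  "trans_density \<alpha> v u =
     (if u \<ge> 0 then
        2 * u / (1 - \<alpha>\<^sup>2) * exp (- (u\<^sup>2 + \<alpha>\<^sup>2 * v\<^sup>2) / (1 - \<alpha>\<^sup>2))
          * bessel_I0 (2 * \<alpha> * u * v / (1 - \<alpha>\<^sup>2))
      else 0)"

text \<open>Conditional law of \<open>(u\<^sub>1, \<dots>, u\<^sub>N)\<close> given \<open>u\<^sub>0\<close> and \<open>\<alpha>\<close>: the Markov chain started at \<open>u\<^sub>0\<close> has
  joint density \<open>q(u\<^sub>1|u\<^sub>0) q(u\<^sub>2|u\<^sub>1) \<dots> q(u\<^sub>N|u\<^bsub>N-1\<^esub>)\<close>. The update \<open>u(0 := u0)\<close> supplies the starting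
  point as the predecessor of the first coordinate.\<close>

definition chain_law :: "nat \<Rightarrow> real \<Rightarrow> real \<Rightarrow> (nat \<Rightarrow> real) measure" where
  "chain_law N u0 \<alpha> =
     density (\<Pi>\<^sub>M i\<in>{1..N}. lborel)
       (\<lambda>u. ennreal (\<Prod>i=1..N. trans_density \<alpha> ((u(0 := u0)) (i - 1)) (u i)))"

definition error_exponent :: "real \<Rightarrow> nat \<Rightarrow> real \<Rightarrow> real \<Rightarrow> real \<Rightarrow> real" where
  "error_exponent P N \<rho> u0 \<alpha> =
     - (1 / real N) *
       ln (\<integral>u. (\<Prod>i=1..N. (1 / (1 + P / (1 + \<rho>) * (u i)\<^sup>2)) powr \<rho>) \<partial>chain_law N u0 \<alpha>)"

definition throughput :: "real \<Rightarrow> real \<Rightarrow> real \<Rightarrow> nat \<Rightarrow> real \<Rightarrow> real" where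
  "throughput P u0 \<alpha> N R =
     R * (1 - (INF \<rho>\<in>{0..1}. exp (- real N * (error_exponent P N \<rho> u0 \<alpha> - \<rho> * R))))"

definition rayleigh_law :: "real measure" where
  "rayleigh_law = density lborel (\<lambda>u. ennreal (if u \<ge> 0 then 2 * u * exp (- u\<^sup>2) else 0))"

definition uniform_law :: "real measure" where
  "uniform_law = uniform_measure lborel {0<..<1}"

text \<open>Joint law of the initial gains \<open>(u\<^bsub>0,k\<^esub>)\<close> and the correlation coefficients \<open>(\<alpha>\<^sub>k)\<close>, \<open>1 \<le> k \<le> K\<close>:
  two independent i.i.d. families.\<close>

definition users_law :: "nat \<Rightarrow> ((nat \<Rightarrow> real) \<times> (nat \<Rightarrow> real)) measure" where
  "users_law K = (\<Pi>\<^sub>M k\<in>{1..K}. rayleigh_law) \<Otimes>\<^sub>M (\<Pi>\<^sub>M k\<in>{1..K}. uniform_law)"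

text \<open>Ties in the maximum have probability zero, so the choice made by \<open>arg_max_on\<close> is immaterial.\<close>

definition selected_user :: "nat \<Rightarrow> (nat \<Rightarrow> real) \<Rightarrow> nat" where
  "selected_user K u0 = arg_max_on u0 {1..K}"

text \<open>The set over which the inner supremum is taken is bounded above for \<open>P > 0\<close>, \<open>u\<^sub>0 \<ge> 0\<close> and
  \<open>0 < \<alpha> < 1\<close>: by Jensen's inequality the throughput is \<open>0\<close> as soon as
  \<open>R \<ge> ln (1 + P * (u\<^sub>0\<^sup>2 + 1))\<close>.\<close>

definition strategy2_throughput :: "real \<Rightarrow> nat \<Rightarrow> real" where
  "strategy2_throughput P K =
     (\<integral>(u0, \<alpha>). (SUP (N, R)\<in>{1..} \<times> {0..}.
          throughput P (u0 (selected_user K u0)) (\<alpha> (selected_user K u0)) N R)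
       \<partial>users_law K)"

end

theory Submission
  imports Defs "HOL-Real_Asymp.Real_Asymp"
begin

text \<open>
  Write \<open>l = ln (1 / \<alpha>)\<close> and \<open>L = ln (P ln K / 2)\<close>. The largest of \<open>K\<close> Rayleigh gains satisfies
  \<open>u\<^sup>2 \<approx> ln K\<close>, after which the gain drifts down like \<open>\<alpha>\<^sup>2\<^sup>i u\<^sup>2\<close>. Over a block of length \<open>N\<close> the mutual
  information is therefore about \<open>L - N l\<close>, and for the error probability to be negligible against the rate
  one must back off by about \<open>(ln L) / N\<close>. The total loss \<open>N l + (ln L) / N\<close> is minimal at
  \<open>N = sqrt (ln L / l)\<close>, where it equals \<open>2 sqrt (l ln L)\<close>.

  Jensen's inequality bounds the Gallager functional from below in terms of \<open>E u\<^sub>i\<^sup>2\<close>, which gives the converse.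
  For achievability take \<open>\<rho> = 1\<close>: by a Chernoff bound at each step, the gains stay above
  \<open>(\<alpha> / (1 + 1 / N))\<^sup>2\<^sup>i u\<^sub>0\<^sup>2\<close> except with doubly exponentially small probability in \<open>L\<close>. All errors are at most
  \<open>O(1 + l)\<close> with \<open>E l = 1\<close>, so the expected throughput is \<open>L - 2 E{sqrt l} sqrt (ln L) + O(1)\<close>.
\<close>


section \<open>The transition kernel\<close>

text \<open>The optimal block length \<open>sqrt (ln L / l)\<close> degenerates at both ends of the
  range of \<alpha>: it drops below 1 when l is large and is unbounded as l tends to 0. The
  single-user bounds must still hold for every \<alpha>, with errors that can be averaged. For large
  l the terms \<open>2 * l\<close> and \<open>16 * l\<close> absorb the discrepancy; for small l the
  achievability proof replaces l by \<open>max l (1 / ln L)\<close>, which caps the block length at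
  about \<open>ln L\<close> and costs a bounded amount. In the converse nothing is known about N and
  R, so very long blocks and very low rates are separate cases. A bounded error suffices at the end
  because \<open>sqrt (ln L)\<close> diverges and the mean of \<open>sqrt l\<close> is positive. A
  second obstacle is measurability: the strategy is a Bochner integral of a supremum over a
  continuum, and a non-measurable integrand would give the value 0. The optimized throughput is
  therefore shown measurable on the whole plane of starting gains and \<alpha>, including values for
  which the formal chain law is no probability measure.\<close>

lemma bessel_I0_sums: "(\<lambda>m. (x / 2) ^ (2 * m) / (fact m)\<^sup>2) sums bessel_I0 x"
proof -
  have "summable (\<lambda>m. (x / 2) ^ (2 * m) / (fact m)\<^sup>2)"
  proof (rule summable_comparison_test')
    show "summable (\<lambda>m. ((x / 2)\<^sup>2) ^ m / fact m)"
      using summable_exp[of "(x / 2)\<^sup>2"] by (simp add: field_simps)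
    fix m :: nat
    have "(1::real) \<le> fact m" by simp
    then have "(fact m :: real) \<le> (fact m)\<^sup>2"
      by (simp add: power2_eq_square)
    then show "norm ((x / 2) ^ (2 * m) / (fact m)\<^sup>2) \<le> ((x / 2)\<^sup>2) ^ m / fact m"
      by (auto simp: power_mult intro!: divide_left_mono)
  qed
  then show ?thesis
    unfolding bessel_I0_def by (rule summable_sums)
qed

lemma bessel_I0_ge_1: "1 \<le> bessel_I0 x"
proof -
  have "sum (\<lambda>m. (x / 2) ^ (2 * m) / (fact m)\<^sup>2) {..<1} \<le> bessel_I0 x"
    unfolding sums_unique[OF bessel_I0_sums[of x]]
    by (rule sum_le_suminf[OF sums_summable[OF bessel_I0_sums]]) (auto simp: power_mult)
  then show ?thesis by simp
qed

lemma borel_measurable_bessel_I0 [measurable]: "bessel_I0 \<in> borel_measurable borel"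
  unfolding bessel_I0_def by measurable

lemma borel_measurable_trans_density [measurable (raw)]:
  assumes [measurable]: "f \<in> borel_measurable M" "g \<in> borel_measurable M" "h \<in> borel_measurable M"
  shows "(\<lambda>x. trans_density (f x) (g x) (h x)) \<in> borel_measurable M"
  unfolding trans_density_def by measurable

lemma trans_density_nonneg: "\<alpha>\<^sup>2 < 1 \<Longrightarrow> 0 \<le> trans_density \<alpha> v u"
  unfolding trans_density_def using bessel_I0_ge_1[of "2 * \<alpha> * u * v / (1 - \<alpha>\<^sup>2)"]
  by (auto intro!: mult_nonneg_nonneg divide_nonneg_nonneg)

text \<open>Rescaling by \<open>sqrt c\<close> reduces this to the known odd Gaussian moments. The
  Laplace transform and second moment of the kernel are computed from it term by term, as are the
  total mass and the exponential moment of the Rayleigh law.\<close>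

lemma nn_integral_gaussian_moment_odd:
  assumes "0 < c"
  shows "(\<integral>\<^sup>+u. ennreal (indicator {0..} u * (2 * u * (u\<^sup>2) ^ m * exp (- c * u\<^sup>2))) \<partial>lborel)
    = ennreal (fact m / c ^ (m + 1))"
proof -
  have sq: "(x ^ m)\<^sup>2 = (x\<^sup>2) ^ m" for x :: real
    by (simp add: power2_eq_square power_mult_distrib)
  have "(\<integral>\<^sup>+u. ennreal (indicator {0..} u * (2 * u * (u\<^sup>2) ^ m * exp (- c * u\<^sup>2))) \<partial>lborel)
    = ennreal (1 / sqrt c) * (\<integral>\<^sup>+u. ennreal (indicator {0..} (0 + 1 / sqrt c * u) *
        (2 * (0 + 1 / sqrt c * u) * ((0 + 1 / sqrt c * u)\<^sup>2) ^ m
          * exp (- c * (0 + 1 / sqrt c * u)\<^sup>2))) \<partial>lborel)"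
    using assms by (subst nn_integral_real_affine[where c = "1 / sqrt c" and t = 0]) auto
  also have "\<dots> = (\<integral>\<^sup>+u. ennreal (2 / c ^ (m + 1)) *
      ennreal (indicator {0..} u *\<^sub>R (exp (- u\<^sup>2) * u ^ (2 * m + 1))) \<partial>lborel)"
    using assms
    apply (subst nn_integral_cmult[symmetric])
     apply simp
    apply (rule nn_integral_cong)
    apply (auto simp: sq ennreal_mult'[symmetric] indicator_def power_divide power_mult_distrib
        zero_le_mult_iff zero_le_divide_iff power_mult field_simps)
    done
  also have "\<dots> = ennreal (2 / c ^ (m + 1)) * ennreal (fact m / 2)"
  proof (subst nn_integral_cmult)
    have "(\<integral>\<^sup>+u. ennreal (indicator {0..} u *\<^sub>R (exp (- u\<^sup>2) * u ^ (2 * m + 1))) \<partial>lborel)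
        = ennreal (fact m / 2)"
      using gaussian_moment_odd_pos[of m]
      by (subst nn_integral_eq_integral)
         (auto simp: has_bochner_integral_iff indicator_def simp del: of_bool_def)
    then show "ennreal (2 / c ^ (m + 1)) *
        (\<integral>\<^sup>+u. ennreal (indicator {0..} u *\<^sub>R (exp (- u\<^sup>2) * u ^ (2 * m + 1))) \<partial>lborel)
        = ennreal (2 / c ^ (m + 1)) * ennreal (fact m / 2)"
      by simp
  qed simp
  finally show ?thesis
    using assms by (simp add: ennreal_mult'[symmetric])
qed
text \<open>In the variable \<open>t = u\<^sup>2 / (1 - \<alpha>\<^sup>2)\<close> the transition density is the mixture of Gamma densities
  of shape \<open>m + 1\<close> with Poisson weights of parameter \<open>\<mu> = \<alpha>\<^sup>2 v\<^sup>2 / (1 - \<alpha>\<^sup>2)\<close>.\<close>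

definition gamma_mixture_term :: "real \<Rightarrow> real \<Rightarrow> nat \<Rightarrow> real \<Rightarrow> real" where
  "gamma_mixture_term \<alpha> v m u =
     exp (- \<alpha>\<^sup>2 * v\<^sup>2 / (1 - \<alpha>\<^sup>2)) * (\<alpha>\<^sup>2 * v\<^sup>2 / (1 - \<alpha>\<^sup>2)) ^ m / (fact m)\<^sup>2 / (1 - \<alpha>\<^sup>2) ^ (m + 1)
       * (indicator {0..} u * (2 * u * (u\<^sup>2) ^ m * exp (- (1 / (1 - \<alpha>\<^sup>2)) * u\<^sup>2)))"

lemma trans_density_sums:
  assumes "\<alpha>\<^sup>2 < 1"
  shows "(\<lambda>m. gamma_mixture_term \<alpha> v m u) sums trans_density \<alpha> v u"
proof (cases "0 \<le> u")
  case True
  define \<beta> where "\<beta> = 1 - \<alpha>\<^sup>2"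
  have "\<beta> > 0" using assms by (simp add: \<beta>_def)
  have "(\<lambda>m. 2 * u / \<beta> * exp (- (u\<^sup>2 + \<alpha>\<^sup>2 * v\<^sup>2) / \<beta>)
      * ((2 * \<alpha> * u * v / \<beta> / 2) ^ (2 * m) / (fact m)\<^sup>2)) sums trans_density \<alpha> v u"
    using True sums_mult[OF bessel_I0_sums[of "2 * \<alpha> * u * v / \<beta>"],
        of "2 * u / \<beta> * exp (- (u\<^sup>2 + \<alpha>\<^sup>2 * v\<^sup>2) / \<beta>)"]
    unfolding trans_density_def \<beta>_def[symmetric] by (simp only: if_True)
  also have "(\<lambda>m. 2 * u / \<beta> * exp (- (u\<^sup>2 + \<alpha>\<^sup>2 * v\<^sup>2) / \<beta>)
      * ((2 * \<alpha> * u * v / \<beta> / 2) ^ (2 * m) / (fact m)\<^sup>2)) = (\<lambda>m. gamma_mixture_term \<alpha> v m u)"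
  proof
    fix m
    have "(2 * \<alpha> * u * v / \<beta> / 2) ^ (2 * m) = (\<alpha>\<^sup>2 * v\<^sup>2 / \<beta>) ^ m * (u\<^sup>2) ^ m / \<beta> ^ m"
      by (simp add: power_mult power_divide power_mult_distrib power2_eq_square)
    moreover have "exp (- (u\<^sup>2 + \<alpha>\<^sup>2 * v\<^sup>2) / \<beta>) = exp (- \<alpha>\<^sup>2 * v\<^sup>2 / \<beta>) * exp (- (1 / \<beta>) * u\<^sup>2)"
      by (simp add: exp_add[symmetric] add_divide_distrib diff_divide_distrib)
    moreover have "2 * u / \<beta> * (E * D) * (p * q / B / F) = E * p / F / (\<beta> * B) * (2 * u * q * D)"
      for E D p q B F :: real
      by (simp add: mult_ac)
    ultimately show "2 * u / \<beta> * exp (- (u\<^sup>2 + \<alpha>\<^sup>2 * v\<^sup>2) / \<beta>)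
      * ((2 * \<alpha> * u * v / \<beta> / 2) ^ (2 * m) / (fact m)\<^sup>2) = gamma_mixture_term \<alpha> v m u"
      using True unfolding gamma_mixture_term_def \<beta>_def[symmetric] by (simp only: indicator_simps
          atLeast_iff power_Suc Suc_eq_plus1[symmetric] mult_1_left) 
  qed
  finally show ?thesis .
qed (simp add: trans_density_def gamma_mixture_term_def)

lemma nn_integral_trans_density_mult:
  assumes "\<alpha>\<^sup>2 < 1" and [measurable]: "f \<in> borel_measurable borel"
  shows "(\<integral>\<^sup>+u. ennreal (trans_density \<alpha> v u) * f u \<partial>lborel)
    = (\<Sum>m. \<integral>\<^sup>+u. ennreal (gamma_mixture_term \<alpha> v m u) * f u \<partial>lborel)"
proof -
  have [measurable]: "gamma_mixture_term \<alpha> v m \<in> borel_measurable borel" for m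
    unfolding gamma_mixture_term_def by measurable
  have nonneg: "0 \<le> gamma_mixture_term \<alpha> v m u" for m u
    using assms(1) unfolding gamma_mixture_term_def by (auto simp: indicator_def)
  have "ennreal (trans_density \<alpha> v u) = (\<Sum>m. ennreal (gamma_mixture_term \<alpha> v m u))" for u
    using suminf_ennreal_eq[OF nonneg trans_density_sums[OF assms(1)]] by simp
  then have "(\<integral>\<^sup>+u. ennreal (trans_density \<alpha> v u) * f u \<partial>lborel)
      = (\<integral>\<^sup>+u. (\<Sum>m. ennreal (gamma_mixture_term \<alpha> v m u) * f u) \<partial>lborel)"
    by simp
  also have "\<dots> = (\<Sum>m. \<integral>\<^sup>+u. ennreal (gamma_mixture_term \<alpha> v m u) * f u \<partial>lborel)"
    by (rule nn_integral_suminf) measurable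
  finally show ?thesis .
qed

text \<open>The tilt changes the mass of the Gamma component of shape m + 1 from 1 to
  \<open>(1 / (1 + s)) ^ (m + 1)\<close>, so the Poisson series is summed at
  \<open>\<mu> / (1 + s)\<close>. The case \<open>s = 0\<close> is the normalization of the kernel;
  positive s gives the Chernoff bound.\<close>

lemma trans_density_laplace:
  assumes "\<alpha>\<^sup>2 < 1" "0 \<le> s"
  shows "(\<integral>\<^sup>+u. ennreal (trans_density \<alpha> v u) * ennreal (exp (- s * (u\<^sup>2 / (1 - \<alpha>\<^sup>2)))) \<partial>lborel)
    = ennreal (exp (- (\<alpha>\<^sup>2 * v\<^sup>2 / (1 - \<alpha>\<^sup>2)) * (s / (1 + s))) / (1 + s))"
proof -
  define \<beta> where "\<beta> = 1 - \<alpha>\<^sup>2"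
  define \<mu> where "\<mu> = \<alpha>\<^sup>2 * v\<^sup>2 / \<beta>"
  have "\<beta> > 0" "\<mu> \<ge> 0" using assms by (simp_all add: \<beta>_def \<mu>_def)
  have mixed: "(\<integral>\<^sup>+u. ennreal (gamma_mixture_term \<alpha> v m u) * ennreal (exp (- s * (u\<^sup>2 / \<beta>))) \<partial>lborel)
      = ennreal (exp (- \<mu>) / (1 + s) * ((\<mu> / (1 + s)) ^ m / fact m))" for m
  proof -
    define c where "c = exp (- \<mu>) * \<mu> ^ m / (fact m)\<^sup>2 / \<beta> ^ (m + 1)"
    have "c \<ge> 0" using \<open>\<beta> > 0\<close> \<open>\<mu> \<ge> 0\<close> by (simp add: c_def)
    have *: "gamma_mixture_term \<alpha> v m u * exp (- s * (u\<^sup>2 / \<beta>))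
       = c * (indicator {0..} u * (2 * u * (u\<^sup>2) ^ m * exp (- ((1 + s) / \<beta>) * u\<^sup>2)))" for u
    proof -
      have "exp (- ((1 + s) / \<beta>) * u\<^sup>2) = exp (- (1 / \<beta>) * u\<^sup>2) * exp (- s * (u\<^sup>2 / \<beta>))"
        by (simp add: mult_exp_exp add_divide_distrib algebra_simps)
      then show ?thesis
        by (simp add: gamma_mixture_term_def \<beta>_def[symmetric] \<mu>_def[symmetric] c_def)
    qed
    have "(\<integral>\<^sup>+u. ennreal (gamma_mixture_term \<alpha> v m u) * ennreal (exp (- s * (u\<^sup>2 / \<beta>))) \<partial>lborel)
      = (\<integral>\<^sup>+u. ennreal c * ennreal (indicator {0..} u * (2 * u * (u\<^sup>2) ^ m * exp (- ((1 + s) / \<beta>) * u\<^sup>2))) \<partial>lborel)"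
      using \<open>c \<ge> 0\<close> by (simp only: ennreal_mult''[symmetric] ennreal_mult'[symmetric] * exp_ge_zero)
    also have "\<dots> = ennreal c * ennreal (fact m / ((1 + s) / \<beta>) ^ (m + 1))"
      using \<open>\<beta> > 0\<close> assms(2)
      by (subst nn_integral_cmult) (simp, subst nn_integral_gaussian_moment_odd, auto)
    also have "\<dots> = ennreal (c * (fact m / ((1 + s) / \<beta>) ^ (m + 1)))"
      using \<open>c \<ge> 0\<close> by (rule ennreal_mult'[symmetric])
    also have "c * (fact m / ((1 + s) / \<beta>) ^ (m + 1)) = exp (- \<mu>) / (1 + s) * ((\<mu> / (1 + s)) ^ m / fact m)"
      using \<open>\<beta> > 0\<close> assms(2) by (simp add: c_def power_divide power2_eq_square)
    finally show ?thesis .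
  qed
  have "(\<lambda>m. exp (- \<mu>) / (1 + s) * ((\<mu> / (1 + s)) ^ m / fact m)) sums
      (exp (- \<mu>) / (1 + s) * exp (\<mu> / (1 + s)))"
    using exp_converges[of "\<mu> / (1 + s)"] by (intro sums_mult) (simp add: field_simps)
  moreover have "exp (- \<mu>) / (1 + s) * exp (\<mu> / (1 + s)) = exp (- \<mu> * (s / (1 + s))) / (1 + s)"
    using assms(2) by (simp add: mult_exp_exp field_simps)
  ultimately have "(\<Sum>m. ennreal (exp (- \<mu>) / (1 + s) * ((\<mu> / (1 + s)) ^ m / fact m)))
      = ennreal (exp (- \<mu> * (s / (1 + s))) / (1 + s))"
    using assms(2) \<open>\<mu> \<ge> 0\<close> by (intro suminf_ennreal_eq) auto
  then show ?thesis
    using nn_integral_trans_density_mult[OF assms(1), of "\<lambda>u. ennreal (exp (- s * (u\<^sup>2 / \<beta>)))" v]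
    unfolding mixed by (simp add: \<beta>_def \<mu>_def)
qed

lemma trans_density_mass:
  assumes "\<alpha>\<^sup>2 < 1"
  shows "(\<integral>\<^sup>+u. ennreal (trans_density \<alpha> v u) \<partial>lborel) = 1"
  using trans_density_laplace[OF assms, of 0 v] by simp

text \<open>The Gamma component of shape m + 1 has mean m + 1 and the Poisson weights have mean
  \<open>\<mu>\<close>, so \<open>t\<close> has mean \<open>\<mu> + 1\<close>; the factor
  \<open>1 - \<alpha>\<^sup>2\<close> converts back to \<open>u\<^sup>2\<close>.\<close>

lemma trans_density_second_moment:
  assumes "\<alpha>\<^sup>2 < 1"
  shows "(\<integral>\<^sup>+u. ennreal (trans_density \<alpha> v u) * ennreal (u\<^sup>2) \<partial>lborel)
    = ennreal (\<alpha>\<^sup>2 * v\<^sup>2 + (1 - \<alpha>\<^sup>2))"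
proof -
  define \<beta> where "\<beta> = 1 - \<alpha>\<^sup>2"
  define \<mu> where "\<mu> = \<alpha>\<^sup>2 * v\<^sup>2 / \<beta>"
  have "\<beta> > 0" "\<mu> \<ge> 0" using assms by (simp_all add: \<beta>_def \<mu>_def)
  have mixed: "(\<integral>\<^sup>+u. ennreal (gamma_mixture_term \<alpha> v m u) * ennreal (u\<^sup>2) \<partial>lborel)
      = ennreal (\<beta> * exp (- \<mu>) * (real (m + 1) * (\<mu> ^ m / fact m)))" for m
  proof -
    define c where "c = exp (- \<mu>) * \<mu> ^ m / (fact m)\<^sup>2 / \<beta> ^ (m + 1)"
    have "c \<ge> 0" using \<open>\<beta> > 0\<close> \<open>\<mu> \<ge> 0\<close> by (simp add: c_def)
    have *: "gamma_mixture_term \<alpha> v m u * u\<^sup>2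
       = c * (indicator {0..} u * (2 * u * (u\<^sup>2) ^ (m + 1) * exp (- (1 / \<beta>) * u\<^sup>2)))" for u
      by (simp add: gamma_mixture_term_def \<beta>_def[symmetric] \<mu>_def[symmetric] c_def)
    have "(\<integral>\<^sup>+u. ennreal (gamma_mixture_term \<alpha> v m u) * ennreal (u\<^sup>2) \<partial>lborel)
      = (\<integral>\<^sup>+u. ennreal c * ennreal (indicator {0..} u * (2 * u * (u\<^sup>2) ^ (m + 1) * exp (- (1 / \<beta>) * u\<^sup>2))) \<partial>lborel)"
      using \<open>c \<ge> 0\<close> by (simp only: ennreal_mult''[symmetric] ennreal_mult'[symmetric] * zero_le_power2)
    also have "\<dots> = ennreal c * ennreal (fact (m + 1) / (1 / \<beta>) ^ (m + 1 + 1))"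
      using \<open>\<beta> > 0\<close>
      by (subst nn_integral_cmult) (simp, subst nn_integral_gaussian_moment_odd, auto)
    also have "\<dots> = ennreal (c * (fact (m + 1) / (1 / \<beta>) ^ (m + 1 + 1)))"
      using \<open>c \<ge> 0\<close> by (rule ennreal_mult'[symmetric])
    also have "c * (fact (m + 1) / (1 / \<beta>) ^ (m + 1 + 1)) = \<beta> * exp (- \<mu>) * (real (m + 1) * (\<mu> ^ m / fact m))"
      using \<open>\<beta> > 0\<close> by (simp add: c_def power_divide power2_eq_square field_simps)
    finally show ?thesis .
  qed
  have exp_sums: "(\<lambda>m. \<mu> ^ m / fact m) sums exp \<mu>"
    using exp_converges[of \<mu>] by (simp add: field_simps)
  have "(\<lambda>m. real m * (\<mu> ^ m / fact m)) sums (\<mu> * exp \<mu>)"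
  proof (rule sums_Suc_imp)
    have "(\<lambda>m. \<mu> * (\<mu> ^ m / fact m)) = (\<lambda>m. real (Suc m) * (\<mu> ^ Suc m / fact (Suc m)))"
    proof
      fix m
      have "\<mu> * (\<mu> ^ m / fact m) = real (Suc m) * (\<mu> * \<mu> ^ m / (real (Suc m) * fact m))"
        by simp
      then show "\<mu> * (\<mu> ^ m / fact m) = real (Suc m) * (\<mu> ^ Suc m / fact (Suc m))"
        by simp
    qed
    then show "(\<lambda>m. real (Suc m) * (\<mu> ^ Suc m / fact (Suc m))) sums (\<mu> * exp \<mu>)"
      using sums_mult[OF exp_sums, of \<mu>] by simp
  qed simp
  from sums_mult[OF sums_add[OF this exp_sums], of "\<beta> * exp (- \<mu>)"]
  have "(\<lambda>m. \<beta> * exp (- \<mu>) * (real (m + 1) * (\<mu> ^ m / fact m))) sums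
      (\<beta> * exp (- \<mu>) * (\<mu> * exp \<mu> + exp \<mu>))"
    by (simp add: algebra_simps add_divide_distrib)
  also have "\<beta> * exp (- \<mu>) * (\<mu> * exp \<mu> + exp \<mu>) = \<beta> * \<mu> + \<beta>"
    by (simp add: exp_minus field_simps)
  finally have "(\<Sum>m. ennreal (\<beta> * exp (- \<mu>) * (real (m + 1) * (\<mu> ^ m / fact m)))) = ennreal (\<beta> * \<mu> + \<beta>)"
    using \<open>\<mu> \<ge> 0\<close> \<open>\<beta> > 0\<close> by (intro suminf_ennreal_eq) auto
  moreover have "\<beta> * \<mu> = \<alpha>\<^sup>2 * v\<^sup>2" using \<open>\<beta> > 0\<close> by (simp add: \<beta>_def \<mu>_def)
  ultimately show ?thesis
    using nn_integral_trans_density_mult[OF assms(1), of "\<lambda>u. ennreal (u\<^sup>2)" v]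
    unfolding mixed by (simp add: \<beta>_def)
qed

text \<open>Chernoff bound with the exponential tilt \<open>s\<close>, for the factor \<open>(1 + s) ^ (-2)\<close>.\<close>

lemma trans_density_lower_tail:
  assumes "\<alpha>\<^sup>2 < 1" "0 \<le> s" "b \<le> v\<^sup>2"
  shows "(\<integral>\<^sup>+u. ennreal (trans_density \<alpha> v u) * indicator {u. u\<^sup>2 < \<alpha>\<^sup>2 / (1 + s)\<^sup>2 * b} u \<partial>lborel)
    \<le> ennreal (exp (- \<alpha>\<^sup>2 * b * (s / (1 + s))\<^sup>2))"
proof -
  define \<beta> where "\<beta> = 1 - \<alpha>\<^sup>2"
  define \<mu> where "\<mu> = \<alpha>\<^sup>2 * v\<^sup>2 / \<beta>"
  have \<beta>: "\<beta> > 0" "\<beta> \<le> 1" "\<mu> \<ge> 0" using assms by (simp_all add: \<beta>_def \<mu>_def)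
  \<comment> \<open>This is the Markov prefactor \<open>exp (s * t)\<close> at the threshold
    \<open>t = \<mu> / (1 + s)\<^sup>2\<close>. That threshold is where the derivative of
    \<open>s * t - \<mu> * s / (1 + s)\<close> in s vanishes, so s is the best tilt for this
    exponent; hence the parametrization of the contraction by s.\<close>
  define c where "c = exp (s * \<mu> / (1 + s)\<^sup>2)"
  have "(\<integral>\<^sup>+u. ennreal (trans_density \<alpha> v u) * indicator {u. u\<^sup>2 < \<alpha>\<^sup>2 / (1 + s)\<^sup>2 * b} u \<partial>lborel)
    \<le> (\<integral>\<^sup>+u. ennreal c * (ennreal (trans_density \<alpha> v u) * ennreal (exp (- s * (u\<^sup>2 / \<beta>)))) \<partial>lborel)"
  proof (rule nn_integral_mono)
    fix u
    have "1 \<le> c * exp (- s * (u\<^sup>2 / \<beta>))" if "u\<^sup>2 < \<alpha>\<^sup>2 / (1 + s)\<^sup>2 * b"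
    proof -
      have "\<alpha>\<^sup>2 / (1 + s)\<^sup>2 * b \<le> \<alpha>\<^sup>2 / (1 + s)\<^sup>2 * v\<^sup>2" using assms by (intro mult_left_mono) auto
      then have "u\<^sup>2 \<le> \<alpha>\<^sup>2 / (1 + s)\<^sup>2 * v\<^sup>2" using that by simp
      then have "u\<^sup>2 / \<beta> \<le> \<mu> / (1 + s)\<^sup>2"
        using \<beta> divide_right_mono[of "u\<^sup>2" "\<alpha>\<^sup>2 / (1 + s)\<^sup>2 * v\<^sup>2" \<beta>] by (simp add: \<mu>_def \<beta>_def mult.commute)
      then have "s * (u\<^sup>2 / \<beta>) \<le> s * (\<mu> / (1 + s)\<^sup>2)"
        using assms(2) by (rule mult_left_mono)
      then show ?thesis by (simp add: c_def mult_exp_exp)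
    qed
    then have "indicator {u. u\<^sup>2 < \<alpha>\<^sup>2 / (1 + s)\<^sup>2 * b} u \<le> ennreal c * ennreal (exp (- s * (u\<^sup>2 / \<beta>)))"
      by (auto simp: indicator_def ennreal_mult'[symmetric] c_def)
    then show "ennreal (trans_density \<alpha> v u) * indicator {u. u\<^sup>2 < \<alpha>\<^sup>2 / (1 + s)\<^sup>2 * b} u
      \<le> ennreal c * (ennreal (trans_density \<alpha> v u) * ennreal (exp (- s * (u\<^sup>2 / \<beta>))))"
      by (subst mult.left_commute) (rule mult_left_mono, auto)
  qed
  also have "\<dots> = ennreal c * ennreal (exp (- \<mu> * (s / (1 + s))) / (1 + s))"
    using trans_density_laplace[OF assms(1,2), of v]
    by (subst nn_integral_cmult) (auto simp: \<beta>_def \<mu>_def)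
  also have "\<dots> = ennreal (c * exp (- \<mu> * (s / (1 + s))) / (1 + s))"
    using assms(2) by (simp add: ennreal_mult'[symmetric] c_def)
  also have "\<dots> \<le> ennreal (exp (- \<alpha>\<^sup>2 * b * (s / (1 + s))\<^sup>2))"
  proof (rule ennreal_leI)
    have "c * exp (- \<mu> * (s / (1 + s))) / (1 + s) \<le> c * exp (- \<mu> * (s / (1 + s))) / 1"
      using assms(2) by (intro divide_left_mono) (auto simp: c_def)
    also have "\<dots> = exp (- (\<mu> * (s / (1 + s))\<^sup>2))"
    proof -
      have "s / (1 + s)\<^sup>2 - s / (1 + s) = - ((s / (1 + s))\<^sup>2)"
        using assms(2) by (simp add: divide_simps power2_eq_square) algebra
      then have "\<mu> * (s / (1 + s)\<^sup>2) - \<mu> * (s / (1 + s)) = - (\<mu> * (s / (1 + s))\<^sup>2)"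
        by (metis mult_minus_right right_diff_distrib)
      then show ?thesis
        by (simp add: c_def mult_exp_exp mult.commute)
    qed
    also have "\<dots> \<le> exp (- (\<alpha>\<^sup>2 * b * (s / (1 + s))\<^sup>2))"
    proof -
      have "\<alpha>\<^sup>2 * b \<le> \<alpha>\<^sup>2 * v\<^sup>2" using assms by (intro mult_left_mono) auto
      \<comment> \<open>Discarding the division by \<open>\<beta> \<le> 1\<close> removes the
        singularity at \<alpha> = 1 and leaves a bound that is easy to iterate.\<close>
      also have "\<dots> \<le> \<mu>"
        using \<beta> unfolding \<mu>_def \<beta>_def[symmetric] by (simp add: pos_le_divide_eq mult_left_le)
      finally show ?thesis by (auto intro: mult_right_mono)
    qed
    finally show "c * exp (- \<mu> * (s / (1 + s))) / (1 + s) \<le> exp (- \<alpha>\<^sup>2 * b * (s / (1 + s))\<^sup>2)"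
      by simp
  qed
  finally show ?thesis .
qed


section \<open>The Markov chain of fading gains\<close>

lemma sets_chain_law [measurable_cong, simp]:
  "sets (chain_law N u0 \<alpha>) = sets (\<Pi>\<^sub>M i\<in>{1..N}. lborel)"
  by (simp add: chain_law_def)

lemma space_chain_law [simp]: "space (chain_law N u0 \<alpha>) = space (\<Pi>\<^sub>M i\<in>{1..N}. (lborel :: real measure))"
  by (simp add: chain_law_def)

text \<open>The parameters are functions of w as well, because joint measurability in the starting
  gain, \<alpha> and the path is required later. The factor with \<open>i = 1\<close> is special:
  its predecessor is the starting point, since 0 is not an index of the product space.\<close>

lemma borel_measurable_chain_density:
  fixes N :: nat
  assumes [measurable]: "a \<in> borel_measurable M" "x \<in> borel_measurable M"
    "u \<in> measurable M (\<Pi>\<^sub>M i\<in>{1..N}. lborel)"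
  shows "(\<lambda>w. \<Prod>i=1..N. trans_density (a w) (((u w)(0 := x w)) (i - 1)) (u w i)) \<in> borel_measurable M"
proof -
  have "(\<lambda>w. trans_density (a w) (((u w)(0 := x w)) (i - 1)) (u w i)) \<in> borel_measurable M"
    if i: "i \<in> {1..N}" for i
  proof -
    have [measurable]: "(\<lambda>w. u w j) \<in> borel_measurable M" if "j \<in> {1..N}" for j
      using measurable_compose[OF assms(3) measurable_component_singleton[OF that]] by simp
    note this[OF i, measurable]
    show ?thesis
    proof (cases "i = 1")
      case True
      then have [measurable]: "(\<lambda>w. u w 1) \<in> borel_measurable M"
        using \<open>(\<lambda>w. u w i) \<in> borel_measurable M\<close> by simp
      then have "(\<lambda>w. trans_density (a w) (x w) (u w 1)) \<in> borel_measurable M"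
        by measurable
      then show ?thesis unfolding True fun_upd_apply by simp
    next
      case False
      then have "i - 1 \<in> {1..N}" "i - 1 \<noteq> 0" using i by auto
      then show ?thesis
        using \<open>\<And>j. j \<in> {1..N} \<Longrightarrow> (\<lambda>w. u w j) \<in> borel_measurable M\<close>[of "i - 1"]
        by (simp only: fun_upd_apply if_False) measurable
    qed
  qed
  then show ?thesis by measurable
qed

lemma nn_integral_chain_law:
  assumes "G \<in> borel_measurable (\<Pi>\<^sub>M i\<in>{1..N}. lborel)"
  shows "(\<integral>\<^sup>+u. G u \<partial>chain_law N u0 \<alpha>) =
    (\<integral>\<^sup>+u. ennreal (\<Prod>i=1..N. trans_density \<alpha> ((u(0 := u0)) (i - 1)) (u i)) * G u \<partial>(\<Pi>\<^sub>M i\<in>{1..N}. lborel))"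
  unfolding chain_law_def using assms
  by (intro nn_integral_density measurable_compose[OF borel_measurable_chain_density measurable_ennreal]) simp_all

lemma product_sigma_finite_lborel: "product_sigma_finite (\<lambda>_. lborel :: real measure)"
  by standard

lemma nn_integral_chain_law_0:
  assumes "G \<in> borel_measurable (\<Pi>\<^sub>M i\<in>{1..0}. lborel)"
  shows "(\<integral>\<^sup>+u. G u \<partial>chain_law 0 u0 \<alpha>) = G (\<lambda>_. undefined)"
  by (subst nn_integral_chain_law[OF assms]) (simp add: PiM_empty nn_integral_count_space_finite)

text \<open>The Markov property in integral form: Fubini splits off the last coordinate, whose
  density depends on the past only through its predecessor. The update at 0 makes the formula cover
  \<open>N = 0\<close>. Total mass, second moments and tail bounds of the chain are all inductions
  through this identity.\<close>

lemma nn_integral_chain_law_Suc: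
  assumes "\<alpha>\<^sup>2 < 1" and G[measurable]: "G \<in> borel_measurable (\<Pi>\<^sub>M i\<in>{1..Suc N}. lborel)"
  shows "(\<integral>\<^sup>+u. G u \<partial>chain_law (Suc N) u0 \<alpha>) =
    (\<integral>\<^sup>+u. \<integral>\<^sup>+z. ennreal (trans_density \<alpha> ((u(0 := u0)) N) z) * G (u(Suc N := z)) \<partial>lborel \<partial>chain_law N u0 \<alpha>)"
proof -
  define d where "d n u = (\<Prod>i=1..n. trans_density \<alpha> ((u(0 := u0)) (i - 1)) (u i))" for n and u :: "nat \<Rightarrow> real"
  have ins: "{1..Suc N} = insert (Suc N) {1..N}" by auto
  have upd [measurable]: "(\<lambda>(u, z). u(Suc N := z)) \<in>
      measurable ((\<Pi>\<^sub>M i\<in>{1..N}. (lborel :: real measure)) \<Otimes>\<^sub>M lborel) (\<Pi>\<^sub>M i\<in>{1..Suc N}. lborel)"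
    unfolding ins by (rule measurable_add_dim)
  have [measurable]: "d n \<in> borel_measurable (\<Pi>\<^sub>M i\<in>{1..n}. lborel)" for n
    unfolding d_def by (rule borel_measurable_chain_density) simp_all
  have d_Suc: "d (Suc N) (u(Suc N := z)) = d N u * trans_density \<alpha> ((u(0 := u0)) N) z" for u z
  proof -
    have "(\<Prod>i=1..N. trans_density \<alpha> (((u(Suc N := z))(0 := u0)) (i - 1)) ((u(Suc N := z)) i)) = d N u"
      unfolding d_def by (intro prod.cong) auto
    then show ?thesis
      unfolding d_def by (simp add: prod.nat_ivl_Suc')
  qed
  have d_nonneg: "0 \<le> d N u" for u
    unfolding d_def using assms(1) by (intro prod_nonneg) (simp add: trans_density_nonneg)
  have meas: "(\<lambda>(u, z). ennreal (trans_density \<alpha> ((u(0 := u0)) N) z) * G (u(Suc N := z)))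
      \<in> borel_measurable ((\<Pi>\<^sub>M i\<in>{1..N}. lborel) \<Otimes>\<^sub>M lborel)"
  proof (cases "N = 0")
    case True
    then show ?thesis using measurable_compose[OF upd G] by (simp add: case_prod_beta)
  next
    case False
    then have "N \<in> {1..N}" by auto
    then have [measurable]: "(\<lambda>u. u N) \<in> borel_measurable (\<Pi>\<^sub>M i\<in>{1..N}. (lborel :: real measure))"
      using measurable_component_singleton[of N "{1..N}" "\<lambda>_. lborel"] by simp
    show ?thesis using False measurable_compose[OF upd G] by (simp add: case_prod_beta)
  qed
  have "(\<integral>\<^sup>+u. G u \<partial>chain_law (Suc N) u0 \<alpha>) =
      (\<integral>\<^sup>+u. ennreal (d (Suc N) u) * G u \<partial>(\<Pi>\<^sub>M i\<in>insert (Suc N) {1..N}. lborel))"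
    unfolding nn_integral_chain_law[OF G] d_def ins ..
  also have "\<dots> = (\<integral>\<^sup>+u. \<integral>\<^sup>+z. ennreal (d (Suc N) (u(Suc N := z))) * G (u(Suc N := z)) \<partial>lborel
      \<partial>(\<Pi>\<^sub>M i\<in>{1..N}. lborel))"
    using product_sigma_finite.product_nn_integral_insert[OF product_sigma_finite_lborel, of "{1..N}" "Suc N"
       "\<lambda>u. ennreal (d (Suc N) u) * G u"]
    unfolding ins[symmetric] by (simp del: One_nat_def)
  also have "\<dots> = (\<integral>\<^sup>+u. ennreal (d N u) * (\<integral>\<^sup>+z. ennreal (trans_density \<alpha> ((u(0 := u0)) N) z) * G (u(Suc N := z)) \<partial>lborel)
      \<partial>(\<Pi>\<^sub>M i\<in>{1..N}. lborel))"
  proof (rule nn_integral_cong)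
    fix u :: "nat \<Rightarrow> real" assume u: "u \<in> space (\<Pi>\<^sub>M i\<in>{1..N}. lborel)"
    have "(\<integral>\<^sup>+z. ennreal (d (Suc N) (u(Suc N := z))) * G (u(Suc N := z)) \<partial>lborel)
      = (\<integral>\<^sup>+z. ennreal (d N u) * (ennreal (trans_density \<alpha> ((u(0 := u0)) N) z) * G (u(Suc N := z))) \<partial>lborel)"
      unfolding d_Suc by (simp only: ennreal_mult'[OF d_nonneg] mult.assoc)
    also have "\<dots> = ennreal (d N u) * (\<integral>\<^sup>+z. (ennreal (trans_density \<alpha> ((u(0 := u0)) N) z) * G (u(Suc N := z))) \<partial>lborel)"
    proof (rule nn_integral_cmult)
      show "(\<lambda>z. ennreal (trans_density \<alpha> ((u(0 := u0)) N) z) * G (u(Suc N := z))) \<in> borel_measurable lborel"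
        using measurable_compose[OF measurable_Pair1'[OF u] meas] by (simp only: case_prod_conv)
    qed
    finally show "(\<integral>\<^sup>+z. ennreal (d (Suc N) (u(Suc N := z))) * G (u(Suc N := z)) \<partial>lborel) = \<dots>" .
  qed
  also have "\<dots> = (\<integral>\<^sup>+u. \<integral>\<^sup>+z. ennreal (trans_density \<alpha> ((u(0 := u0)) N) z) * G (u(Suc N := z)) \<partial>lborel
      \<partial>chain_law N u0 \<alpha>)"
    using lborel.borel_measurable_nn_integral[OF meas]
    by (subst nn_integral_chain_law) (simp_all add: d_def)
  finally show ?thesis .
qed

lemma (in prob_space) nn_integral_affine:
  assumes [measurable]: "f \<in> borel_measurable M"
  shows "(\<integral>\<^sup>+x. c * f x + d \<partial>M) = c * (\<integral>\<^sup>+x. f x \<partial>M) + d"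
  by (simp add: nn_integral_add nn_integral_cmult emeasure_space_1)

lemma prob_space_chain_law:
  assumes "\<alpha>\<^sup>2 < 1"
  shows "prob_space (chain_law N u0 \<alpha>)"
proof
  have "(\<integral>\<^sup>+u. 1 \<partial>chain_law N u0 \<alpha>) = 1"
  proof (induction N)
    case 0
    show ?case by (subst nn_integral_chain_law_0) auto
  next
    case (Suc N)
    show ?case
      using Suc.IH by (subst nn_integral_chain_law_Suc[OF assms]) (simp_all add: trans_density_mass[OF assms])
  qed
  then show "emeasure (chain_law N u0 \<alpha>) (space (chain_law N u0 \<alpha>)) = 1"
    by simp
qed

lemma borel_measurable_component:
  "i \<in> I \<Longrightarrow> (\<lambda>u. u i) \<in> borel_measurable (\<Pi>\<^sub>M i\<in>I. (lborel :: real measure))"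
  using measurable_component_singleton[of i I "\<lambda>_. lborel"] by simp

text \<open>One step of the chain maps the mean power m to
  \<open>\<alpha>\<^sup>2 * m + (1 - \<alpha>\<^sup>2)\<close>, an affine map with fixed point 1.
  Coordinates after i integrate out with mass 1.\<close>

lemma chain_law_second_moment:
  assumes "\<alpha>\<^sup>2 < 1" "i \<in> {1..N}"
  shows "(\<integral>\<^sup>+u. ennreal ((u i)\<^sup>2) \<partial>chain_law N u0 \<alpha>) = ennreal ((\<alpha>\<^sup>2) ^ i * u0\<^sup>2 + (1 - (\<alpha>\<^sup>2) ^ i))"
  using assms(2)
proof (induction N arbitrary: i)
  case (Suc N)
  have meas: "(\<lambda>u. ennreal ((u i)\<^sup>2)) \<in> borel_measurable (\<Pi>\<^sub>M i\<in>{1..Suc N}. lborel)"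
    using borel_measurable_component[OF Suc.prems] by measurable
  show ?case
  proof (cases "i = Suc N")
    case False
    then have "i \<in> {1..N}" using Suc.prems by auto
    note IH = Suc.IH[OF this]
    have "(\<integral>\<^sup>+z. ennreal (trans_density \<alpha> ((u(0 := u0)) N) z) * ennreal ((u i)\<^sup>2) \<partial>lborel) = ennreal ((u i)\<^sup>2)" for u
      by (subst nn_integral_multc) (simp_all add: trans_density_mass[OF assms(1)])
    then show ?thesis
      using IH False by (subst nn_integral_chain_law_Suc[OF assms(1) meas]) simp
  next
    case True
    have prev: "(\<integral>\<^sup>+u. ennreal (((u(0 := u0)) N)\<^sup>2) \<partial>chain_law N u0 \<alpha>)
        = ennreal ((\<alpha>\<^sup>2) ^ N * u0\<^sup>2 + (1 - (\<alpha>\<^sup>2) ^ N))"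
    proof (cases "N = 0")
      case True
      then show ?thesis using nn_integral_chain_law_0[of "\<lambda>_. ennreal (u0\<^sup>2)" u0 \<alpha>] by (simp only: fun_upd_same) simp
    next
      case False
      then show ?thesis using Suc.IH[of N] by simp
    qed
    have meas_prev: "(\<lambda>u. ennreal (((u(0 := u0)) N)\<^sup>2)) \<in> borel_measurable (chain_law N u0 \<alpha>)"
    proof (cases "N = 0")
      case False
      then have "(\<lambda>u. u N) \<in> borel_measurable (\<Pi>\<^sub>M i\<in>{1..N}. (lborel :: real measure))"
        by (intro borel_measurable_component) auto
      from measurable_compose[OF this, of "\<lambda>x. ennreal (x\<^sup>2)" borel]
      show ?thesis
        using False by (simp only: fun_upd_apply if_False measurable_cong_sets[OF sets_chain_law refl]) simp
    qed simp
    have "(\<integral>\<^sup>+u. ennreal ((u i)\<^sup>2) \<partial>chain_law (Suc N) u0 \<alpha>) =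
      (\<integral>\<^sup>+u. ennreal (\<alpha>\<^sup>2) * ennreal (((u(0 := u0)) N)\<^sup>2) + ennreal (1 - \<alpha>\<^sup>2) \<partial>chain_law N u0 \<alpha>)"
    proof (subst nn_integral_chain_law_Suc[OF assms(1) meas], rule nn_integral_cong)
      fix u :: "nat \<Rightarrow> real"
      show "(\<integral>\<^sup>+z. ennreal (trans_density \<alpha> ((u(0 := u0)) N) z) * ennreal (((u(Suc N := z)) i)\<^sup>2) \<partial>lborel)
          = ennreal (\<alpha>\<^sup>2) * ennreal (((u(0 := u0)) N)\<^sup>2) + ennreal (1 - \<alpha>\<^sup>2)"
      proof -
        have "ennreal (\<alpha>\<^sup>2 * x\<^sup>2 + (1 - \<alpha>\<^sup>2)) = ennreal (\<alpha>\<^sup>2) * ennreal (x\<^sup>2) + ennreal (1 - \<alpha>\<^sup>2)" for x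
          using assms(1) by (subst ennreal_plus) (auto simp: ennreal_mult')
        then show ?thesis
          unfolding True fun_upd_same trans_density_second_moment[OF assms(1)] .
      qed
    qed
    also have "\<dots> = ennreal (\<alpha>\<^sup>2) * ennreal ((\<alpha>\<^sup>2) ^ N * u0\<^sup>2 + (1 - (\<alpha>\<^sup>2) ^ N)) + ennreal (1 - \<alpha>\<^sup>2)"
      using prob_space.nn_integral_affine[OF prob_space_chain_law[OF assms(1)] meas_prev] unfolding prev .
    also have "\<dots> = ennreal (\<alpha>\<^sup>2 * ((\<alpha>\<^sup>2) ^ N * u0\<^sup>2 + (1 - (\<alpha>\<^sup>2) ^ N)) + (1 - \<alpha>\<^sup>2))"
      using assms(1) power_le_one[of "\<alpha>\<^sup>2" N] by (subst ennreal_plus) (simp_all del: ennreal_plus add: ennreal_mult')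
    also have "\<alpha>\<^sup>2 * ((\<alpha>\<^sup>2) ^ N * u0\<^sup>2 + (1 - (\<alpha>\<^sup>2) ^ N)) + (1 - \<alpha>\<^sup>2) = (\<alpha>\<^sup>2) ^ i * u0\<^sup>2 + (1 - (\<alpha>\<^sup>2) ^ i)"
      using True by (simp add: algebra_simps)
    finally show ?thesis .
  qed
qed simp

text \<open>The set ranges over all functions, not only the extensional ones forming the product
  space, so it need not be a measurable set of that space. Its indicator is measurable because it is
  one minus a finite product of coordinatewise measurable factors.\<close>

lemma borel_measurable_indicator_ex_less:
  "(indicator {u. \<exists>i\<in>{1..N}. (u i)\<^sup>2 < b i} :: _ \<Rightarrow> ennreal) \<in> borel_measurable (\<Pi>\<^sub>M i\<in>{1..N :: nat}. (lborel :: real measure))"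
proof -
  let ?B = "{u :: nat \<Rightarrow> real. \<exists>i\<in>{1..N}. (u i)\<^sup>2 < b i}"
  have "indicator ?B u = (1 :: ennreal) - (\<Prod>i\<in>{1..N}. if (u i)\<^sup>2 < b i then 0 else 1)" for u :: "nat \<Rightarrow> real"
  proof (cases "u \<in> ?B")
    case True
    then obtain i where "i \<in> {1..N}" "(u i)\<^sup>2 < b i" by auto
    then have "(\<Prod>i\<in>{1..N}. if (u i)\<^sup>2 < b i then 0 else (1::ennreal)) = 0" by (intro prod_zero) auto
    then show ?thesis using True by (simp only:) simp
  next
    case False
    then have "(\<Prod>i\<in>{1..N}. if (u i)\<^sup>2 < b i then 0 else (1::ennreal)) = 1"
      by (intro prod.neutral) auto
    then show ?thesis using False by (simp only:) simp
  qed
  then have "(indicator ?B :: _ \<Rightarrow> ennreal) = (\<lambda>u. 1 - (\<Prod>i\<in>{1..N}. if (u i)\<^sup>2 < b i then 0 else 1))"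
    by (rule ext)
  then show ?thesis by (simp only:) measurable
qed

text \<open>A union bound over the first failure: if the i-th gain is still above its threshold,
  falling below the next one has probability controlled by the one-step Chernoff bound. Hence the
  summation over predecessors \<open>i < N\<close>, with \<open>i = 0\<close> standing for the
  starting gain.\<close>

lemma chain_law_lower_tail:
  assumes "\<alpha>\<^sup>2 < 1" "0 \<le> s" "y \<le> u0\<^sup>2"
  shows "(\<integral>\<^sup>+u. indicator {u. \<exists>i\<in>{1..N}. (u i)\<^sup>2 < (\<alpha>\<^sup>2 / (1 + s)\<^sup>2) ^ i * y} u \<partial>chain_law N u0 \<alpha>)
    \<le> (\<Sum>i<N. ennreal (exp (- \<alpha>\<^sup>2 * ((\<alpha>\<^sup>2 / (1 + s)\<^sup>2) ^ i * y) * (s / (1 + s))\<^sup>2)))"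
proof (induction N)
  case 0
  then show ?case by (subst nn_integral_chain_law_0) auto
next
  case (Suc N)
  define b where "b i = (\<alpha>\<^sup>2 / (1 + s)\<^sup>2) ^ i * y" for i
  define B where "B N = {u. \<exists>i\<in>{1..N}. (u i)\<^sup>2 < b i}" for N :: nat
  define e where "e = ennreal (exp (- \<alpha>\<^sup>2 * b N * (s / (1 + s))\<^sup>2))"
  have meas: "(indicator (B N) :: _ \<Rightarrow> ennreal) \<in> borel_measurable (\<Pi>\<^sub>M i\<in>{1..N}. lborel)" for N
    unfolding B_def by (rule borel_measurable_indicator_ex_less)
  have inner: "(\<integral>\<^sup>+z. ennreal (trans_density \<alpha> ((u(0 := u0)) N) z) * indicator (B (Suc N)) (u(Suc N := z)) \<partial>lborel)
      \<le> indicator (B N) u + e" for u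
  proof (cases "u \<in> B N")
    case True
    have "(\<integral>\<^sup>+z. ennreal (trans_density \<alpha> ((u(0 := u0)) N) z) * indicator (B (Suc N)) (u(Suc N := z)) \<partial>lborel)
      \<le> (\<integral>\<^sup>+z. ennreal (trans_density \<alpha> ((u(0 := u0)) N) z) \<partial>lborel)"
      by (intro nn_integral_mono) (auto simp: indicator_def)
    also have "\<dots> = 1" by (rule trans_density_mass[OF assms(1)])
    finally show ?thesis using True by (simp add: add_increasing2)
  next
    case False
    then have prev: "b N \<le> ((u(0 := u0)) N)\<^sup>2"
    proof (cases "N = 0")
      case True
      then show ?thesis using assms(3) by (simp add: b_def)
    next
      case False
      then have "N \<in> {1..N}" by auto
      then have "\<not> (u N)\<^sup>2 < b N" using \<open>u \<notin> B N\<close> unfolding B_def by blast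
      then show ?thesis using False by simp
    qed
    have "u(Suc N := z) \<in> B (Suc N) \<Longrightarrow> z\<^sup>2 < \<alpha>\<^sup>2 / (1 + s)\<^sup>2 * b N" for z
      using False by (force simp: B_def b_def split: if_splits)
    then have "(\<integral>\<^sup>+z. ennreal (trans_density \<alpha> ((u(0 := u0)) N) z) * indicator (B (Suc N)) (u(Suc N := z)) \<partial>lborel)
      \<le> (\<integral>\<^sup>+z. ennreal (trans_density \<alpha> ((u(0 := u0)) N) z) * indicator {z. z\<^sup>2 < \<alpha>\<^sup>2 / (1 + s)\<^sup>2 * b N} z \<partial>lborel)"
      by (intro nn_integral_mono mult_left_mono) (auto simp: indicator_def)
    also have "\<dots> \<le> e"
      unfolding e_def by (rule trans_density_lower_tail[OF assms(1,2) prev])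
    finally show ?thesis using False by simp
  qed
  have "(\<integral>\<^sup>+u. indicator (B (Suc N)) u \<partial>chain_law (Suc N) u0 \<alpha>) \<le> (\<integral>\<^sup>+u. indicator (B N) u + e \<partial>chain_law N u0 \<alpha>)"
    unfolding nn_integral_chain_law_Suc[OF assms(1) meas] by (intro nn_integral_mono inner)
  also have "\<dots> = (\<integral>\<^sup>+u. indicator (B N) u \<partial>chain_law N u0 \<alpha>) + e"
    using prob_space.nn_integral_affine[OF prob_space_chain_law[OF assms(1)], of "indicator (B N)" N u0 1 e] meas[of N]
    by (simp add: measurable_cong_sets[OF sets_chain_law refl] del: One_nat_def)
  also have "\<dots> \<le> (\<Sum>i<N. ennreal (exp (- \<alpha>\<^sup>2 * b i * (s / (1 + s))\<^sup>2))) + e"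
    using Suc.IH unfolding B_def b_def by (rule add_right_mono)
  finally show ?case
    unfolding B_def b_def e_def by simp
qed


section \<open>Error exponent and throughput\<close>

definition gallager :: "real \<Rightarrow> nat \<Rightarrow> real \<Rightarrow> (nat \<Rightarrow> real) \<Rightarrow> real" where
  "gallager P N \<rho> u = (\<Prod>i=1..N. (1 / (1 + P / (1 + \<rho>) * (u i)\<^sup>2)) powr \<rho>)"

text \<open>The logarithm in \<open>error_exponent\<close> is undone by the exponential in
  \<open>throughput\<close>; for admissible parameters this expectation is what remains of the
  pair.\<close>

definition gallager_mean :: "real \<Rightarrow> nat \<Rightarrow> real \<Rightarrow> real \<Rightarrow> real \<Rightarrow> real" where
  "gallager_mean P N \<rho> x \<alpha> = (\<integral>u. gallager P N \<rho> u \<partial>chain_law N x \<alpha>)"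

lemma borel_measurable_gallager [measurable]:
  "gallager P N \<rho> \<in> borel_measurable (\<Pi>\<^sub>M i\<in>{1..N}. (lborel :: real measure))"
  unfolding gallager_def[abs_def] by measurable

text \<open>The last two bounds remove \<rho> from the signal-to-noise ratio and then from the
  power. The third feeds the Jensen bound, the fourth the divergence argument for
  \<open>\<alpha>\<^sup>2 > 1\<close>.\<close>

lemma gallager_factor_bounds:
  assumes "0 < P" "0 \<le> \<rho>" "\<rho> \<le> 1"
  shows "0 \<le> (1 / (1 + P / (1 + \<rho>) * (v :: real)\<^sup>2)) powr \<rho>"
    and "(1 / (1 + P / (1 + \<rho>) * v\<^sup>2)) powr \<rho> \<le> 1"
    and "(1 / (1 + P * v\<^sup>2)) powr \<rho> \<le> (1 / (1 + P / (1 + \<rho>) * v\<^sup>2)) powr \<rho>"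
    and "1 / (1 + P * v\<^sup>2) \<le> (1 / (1 + P / (1 + \<rho>) * v\<^sup>2)) powr \<rho>"
proof -
  have Pv: "0 \<le> P / (1 + \<rho>) * v\<^sup>2" "0 \<le> P * v\<^sup>2" using assms by auto
  show "0 \<le> (1 / (1 + P / (1 + \<rho>) * v\<^sup>2)) powr \<rho>" by simp
  show "(1 / (1 + P / (1 + \<rho>) * v\<^sup>2)) powr \<rho> \<le> 1"
  proof (rule powr_le1)
    have "1 / (1 + P / (1 + \<rho>) * v\<^sup>2) \<le> 1" "0 \<le> 1 / (1 + P / (1 + \<rho>) * v\<^sup>2)"
      using Pv(1) by (subst divide_le_eq_1_pos, linarith+, simp)
    then show "\<bar>1 / (1 + P / (1 + \<rho>) * v\<^sup>2)\<bar> \<le> 1"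
      by linarith
  qed (use assms Pv in auto)
  have "P / (1 + \<rho>) * v\<^sup>2 \<le> P * v\<^sup>2"
    using assms by (intro mult_right_mono) (auto simp: divide_le_eq mult_le_cancel_left1)
  then have le: "1 / (1 + P * v\<^sup>2) \<le> 1 / (1 + P / (1 + \<rho>) * v\<^sup>2)"
    using Pv by (intro divide_left_mono) (auto intro!: mult_pos_pos add_pos_nonneg)
  then show *: "(1 / (1 + P * v\<^sup>2)) powr \<rho> \<le> (1 / (1 + P / (1 + \<rho>) * v\<^sup>2)) powr \<rho>"
    using assms Pv by (intro powr_mono2) auto
  have "1 / (1 + P * v\<^sup>2) = (1 / (1 + P * v\<^sup>2)) powr 1"
    using Pv by (simp add: powr_one)
  also have "\<dots> \<le> (1 / (1 + P * v\<^sup>2)) powr \<rho>"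
  proof (rule powr_mono')
    show "1 / (1 + P * v\<^sup>2) \<le> 1"
      using Pv(2) by (subst divide_le_eq_1_pos) linarith+
  qed (use assms Pv in auto)
  finally show "1 / (1 + P * v\<^sup>2) \<le> (1 / (1 + P / (1 + \<rho>) * v\<^sup>2)) powr \<rho>"
    using * by linarith
qed

lemma gallager_bounds:
  assumes "0 < P" "0 \<le> \<rho>" "\<rho> \<le> 1"
  shows "0 \<le> gallager P N \<rho> u" "gallager P N \<rho> u \<le> 1"
  unfolding gallager_def using gallager_factor_bounds[OF assms] by (auto intro!: prod_nonneg prod_le_1)

lemma integrable_gallager:
  assumes "0 < P" "0 \<le> \<rho>" "\<rho> \<le> 1" "\<alpha>\<^sup>2 < 1"
  shows "integrable (chain_law N x \<alpha>) (gallager P N \<rho>)"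
proof -
  interpret prob_space "chain_law N x \<alpha>" by (rule prob_space_chain_law[OF assms(4)])
  show ?thesis
    using gallager_bounds[OF assms(1-3)]
    by (intro integrable_const_bound[where B = 1]) (auto simp: measurable_cong_sets[OF sets_chain_law refl] simp del: One_nat_def)
qed

text \<open>Dominated convergence with the constant 1. Continuity in \<rho> is what later allows the
  optimization to run over a countable dense set.\<close>

lemma continuous_on_gallager_mean:
  assumes "0 < P" "\<alpha>\<^sup>2 < 1"
  shows "continuous_on {0..1} (\<lambda>\<rho>. gallager_mean P N \<rho> x \<alpha>)"
proof (rule continuous_on_sequentiallyI)
  interpret prob_space "chain_law N x \<alpha>" by (rule prob_space_chain_law[OF assms(2)])
  fix r :: "nat \<Rightarrow> real" and \<rho> :: real
  assume r: "\<forall>n. r n \<in> {0..1}" "\<rho> \<in> {0..1}" "r \<longlonglongrightarrow> \<rho>"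
  show "(\<lambda>n. gallager_mean P N (r n) x \<alpha>) \<longlonglongrightarrow> gallager_mean P N \<rho> x \<alpha>"
    unfolding gallager_mean_def
  proof (rule integral_dominated_convergence[where w = "\<lambda>_. 1"])
    show "AE u in chain_law N x \<alpha>. (\<lambda>n. gallager P N (r n) u) \<longlonglongrightarrow> gallager P N \<rho> u"
    proof (rule AE_I2)
      fix u :: "nat \<Rightarrow> real"
      have "0 < 1 + P / (1 + \<rho>) * (u i)\<^sup>2" for i
        using assms(1) r(2) by (intro add_pos_nonneg) auto
      then have "1 + P / (1 + \<rho>) * (u i)\<^sup>2 \<noteq> 0" "1 / (1 + P / (1 + \<rho>) * (u i)\<^sup>2) \<noteq> 0" for i
        by (metis less_irrefl, metis less_irrefl divide_eq_0_iff zero_neq_one)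
      moreover have "1 + \<rho> \<noteq> 0" using r(2) by auto
      ultimately show "(\<lambda>n. gallager P N (r n) u) \<longlonglongrightarrow> gallager P N \<rho> u"
        unfolding gallager_def using r(3) by (intro tendsto_intros) auto
    qed
    show "AE u in chain_law N x \<alpha>. norm (gallager P N (r n) u) \<le> 1" for n
      using r(1) gallager_bounds[of P "r n" N] assms(1) by (intro AE_I2) auto
  qed (simp_all add: measurable_cong_sets[OF sets_chain_law refl] del: One_nat_def)
qed

text \<open>Jensen's inequality for the concave logarithm, through its tangent at the mean received power.\<close>

lemma gallager_mean_lower:
  assumes "0 < P" "0 \<le> \<rho>" "\<rho> \<le> 1" "\<alpha>\<^sup>2 < 1"
  shows "exp (- \<rho> * (\<Sum>i=1..N. ln (1 + P * ((\<alpha>\<^sup>2) ^ i * x\<^sup>2 + (1 - (\<alpha>\<^sup>2) ^ i))))) \<le> gallager_mean P N \<rho> x \<alpha>"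
proof -
  interpret prob_space "chain_law N x \<alpha>" by (rule prob_space_chain_law[OF assms(4)])
  define m where "m i = (\<alpha>\<^sup>2) ^ i * x\<^sup>2 + (1 - (\<alpha>\<^sup>2) ^ i)" for i
  define c where "c i = 1 + P * m i" for i
  define A where "A = exp (- \<rho> * (\<Sum>i=1..N. ln (c i)))"
  have m_nonneg: "0 \<le> m i" for i
    using assms(4) power_le_one[of "\<alpha>\<^sup>2" i] by (simp add: m_def)
  have c_pos: "0 < c i" for i
    using m_nonneg assms(1) by (auto simp: c_def intro!: add_pos_nonneg)
  have square: "has_bochner_integral (chain_law N x \<alpha>) (\<lambda>u. (u i)\<^sup>2) (m i)" if "i \<in> {1..N}" for i
    using chain_law_second_moment[OF assms(4) that, of x] m_nonneg[of i] borel_measurable_component[OF that]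
    unfolding m_def
    by (intro has_bochner_integral_nn_integral) (auto simp: measurable_cong_sets[OF sets_chain_law refl] simp del: One_nat_def)
  \<comment> \<open>Two tangent inequalities are combined, \<open>exp t \<ge> 1 + t\<close> and
    \<open>ln t \<le> t - 1\<close>. The resulting minorant is affine in the powers
    \<open>(u i)\<^sup>2\<close>, so its mean depends only on second moments and the dependence
    along the chain is harmless; the correction has mean zero because \<open>c i\<close> is the mean
    of \<open>1 + P * (u i)\<^sup>2\<close>.\<close>
  have lower: "A * (1 - \<rho> * (\<Sum>i=1..N. (1 + P * (u i)\<^sup>2) / c i - 1)) \<le> gallager P N \<rho> u" for u
  proof -
    have "A * (1 - \<rho> * (\<Sum>i=1..N. (1 + P * (u i)\<^sup>2) / c i - 1))
        \<le> A * exp (- \<rho> * (\<Sum>i=1..N. (1 + P * (u i)\<^sup>2) / c i - 1))"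
      using exp_ge_add_one_self[of "- \<rho> * (\<Sum>i=1..N. (1 + P * (u i)\<^sup>2) / c i - 1)"]
      by (intro mult_left_mono) (auto simp: A_def)
    also have "\<dots> = (\<Prod>i=1..N. exp (- \<rho> * (ln (c i) + ((1 + P * (u i)\<^sup>2) / c i - 1))))"
    proof -
      have "- \<rho> * (\<Sum>i=1..N. ln (c i)) + - \<rho> * (\<Sum>i=1..N. (1 + P * (u i)\<^sup>2) / c i - 1)
          = (\<Sum>i=1..N. - \<rho> * (ln (c i) + ((1 + P * (u i)\<^sup>2) / c i - 1)))"
        by (simp only: sum.distrib distrib_left sum_distrib_left)
      then show ?thesis
        unfolding A_def mult_exp_exp by (simp only: exp_sum finite_atLeastAtMost)
    qed
    also have "\<dots> \<le> gallager P N \<rho> u"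
      unfolding gallager_def
    proof (rule prod_mono, safe)
      fix i
      have pos: "0 < 1 + P * (u i)\<^sup>2" using assms(1) by (intro add_pos_nonneg) auto
      have "ln (1 + P * (u i)\<^sup>2) - ln (c i) = ln ((1 + P * (u i)\<^sup>2) / c i)"
        using pos c_pos[of i] by (simp add: ln_div)
      also have "\<dots> \<le> (1 + P * (u i)\<^sup>2) / c i - 1"
        using pos c_pos[of i] by (intro ln_le_minus_one) auto
      finally have "- \<rho> * (ln (c i) + ((1 + P * (u i)\<^sup>2) / c i - 1)) \<le> - \<rho> * ln (1 + P * (u i)\<^sup>2)"
        using assms(2) by (simp add: mult_left_mono)
      then have "exp (- \<rho> * (ln (c i) + ((1 + P * (u i)\<^sup>2) / c i - 1))) \<le> exp (- \<rho> * ln (1 + P * (u i)\<^sup>2))"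
        by simp
      also have "\<dots> = (1 / (1 + P * (u i)\<^sup>2)) powr \<rho>"
        using pos by (simp add: powr_def ln_div)
      also have "\<dots> \<le> (1 / (1 + P / (1 + \<rho>) * (u i)\<^sup>2)) powr \<rho>"
        by (rule gallager_factor_bounds(3)[OF assms(1-3)])
      finally show "exp (- \<rho> * (ln (c i) + ((1 + P * (u i)\<^sup>2) / c i - 1))) \<le> (1 / (1 + P / (1 + \<rho>) * (u i)\<^sup>2)) powr \<rho>" .
    qed simp
    finally show ?thesis .
  qed
  have const: "has_bochner_integral (chain_law N x \<alpha>) (\<lambda>_. a) a" for a :: real
    by (simp add: has_bochner_integral_iff prob_space del: space_chain_law)
  have int: "has_bochner_integral (chain_law N x \<alpha>) (\<lambda>u. A * (1 - \<rho> * (\<Sum>i=1..N. (1 + P * (u i)\<^sup>2) / c i - 1)))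
      (A * (1 - \<rho> * (\<Sum>i=1..N. (1 + P * m i) / c i - 1)))"
    by (intro has_bochner_integral_mult_right has_bochner_integral_diff has_bochner_integral_sum
       has_bochner_integral_divide_zero has_bochner_integral_add square const)
  have "(\<Sum>i=1..N. (1 + P * m i) / c i - 1) = 0"
    using c_pos by (intro sum.neutral) (simp add: c_def[symmetric] less_imp_neq[symmetric])
  then have "A = (\<integral>u. A * (1 - \<rho> * (\<Sum>i=1..N. (1 + P * (u i)\<^sup>2) / c i - 1)) \<partial>chain_law N x \<alpha>)"
    using has_bochner_integral_integral_eq[OF int] by simp
  also have "\<dots> \<le> gallager_mean P N \<rho> x \<alpha>"
    unfolding gallager_mean_def using int lower
    by (intro integral_mono integrable_gallager assms) (auto simp: has_bochner_integral_iff)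
  finally show ?thesis unfolding A_def c_def m_def .
qed

lemma gallager_mean_pos:
  assumes "0 < P" "0 \<le> \<rho>" "\<rho> \<le> 1" "\<alpha>\<^sup>2 < 1"
  shows "0 < gallager_mean P N \<rho> x \<alpha>"
  using gallager_mean_lower[OF assms] by (rule less_le_trans[OF exp_gt_zero])

text \<open>On the event that some gain falls below its threshold the functional is bounded by 1;
  off that event every factor is bounded by its value at the threshold. Letting y be any lower bound
  for \<open>x\<^sup>2\<close> makes the estimate uniform over strong starting gains.\<close>

lemma gallager_mean_upper:
  assumes "0 < P" "\<alpha>\<^sup>2 < 1" "0 \<le> s" "0 \<le> y" "y \<le> x\<^sup>2"
  shows "gallager_mean P N 1 x \<alpha> \<le> (\<Prod>i=1..N. 1 / (1 + P / 2 * ((\<alpha>\<^sup>2 / (1 + s)\<^sup>2) ^ i * y)))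
    + (\<Sum>i<N. exp (- \<alpha>\<^sup>2 * ((\<alpha>\<^sup>2 / (1 + s)\<^sup>2) ^ i * y) * (s / (1 + s))\<^sup>2))"
proof -
  interpret prob_space "chain_law N x \<alpha>" by (rule prob_space_chain_law[OF assms(2)])
  define b where "b i = (\<alpha>\<^sup>2 / (1 + s)\<^sup>2) ^ i * y" for i
  define B where "B = {u. \<exists>i\<in>{1..N}. (u i)\<^sup>2 < b i}"
  define C where "C = (\<Prod>i=1..N. 1 / (1 + P / 2 * b i))"
  have b_nonneg: "0 \<le> b i" for i using assms by (simp add: b_def)
  have C_nonneg: "0 \<le> C" using b_nonneg assms(1) by (auto simp: C_def intro!: prod_nonneg)
  have "gallager P N 1 u \<le> C" if "u \<notin> B" for u
    unfolding gallager_def C_def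
  proof (rule prod_mono, safe)
    fix i assume "i \<in> {1..N}"
    with that have "b i \<le> (u i)\<^sup>2" by (force simp: B_def)
    then have "1 / (1 + P / 2 * (u i)\<^sup>2) \<le> 1 / (1 + P / 2 * b i)"
      using assms(1) b_nonneg[of i] by (intro divide_left_mono) (auto intro!: mult_pos_pos add_pos_nonneg)
    moreover have "0 < 1 + P / 2 * (u i)\<^sup>2" using assms(1) by (intro add_pos_nonneg) auto
    ultimately show "(1 / (1 + P / (1 + 1) * (u i)\<^sup>2)) powr 1 \<le> 1 / (1 + P / 2 * b i)"
      by (simp add: powr_one)
  qed simp
  then have ptw: "ennreal (gallager P N 1 u) \<le> 1 * indicator B u + ennreal C" for u
    using gallager_bounds(2)[OF assms(1), of 1 N u]
    by (cases "u \<in> B") (auto intro!: ennreal_leI add_increasing2 simp: ennreal_le_1)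
  have meas: "indicator B \<in> borel_measurable (chain_law N x \<alpha>)"
    using borel_measurable_indicator_ex_less[of N b] unfolding B_def
    by (simp add: measurable_cong_sets[OF sets_chain_law refl] del: One_nat_def)
  have "ennreal (gallager_mean P N 1 x \<alpha>) = (\<integral>\<^sup>+u. ennreal (gallager P N 1 u) \<partial>chain_law N x \<alpha>)"
    unfolding gallager_mean_def using gallager_bounds[OF assms(1)]
    by (intro nn_integral_eq_integral[symmetric] integrable_gallager assms) auto
  also have "\<dots> \<le> (\<integral>\<^sup>+u. 1 * indicator B u + ennreal C \<partial>chain_law N x \<alpha>)"
    by (intro nn_integral_mono ptw)
  also have "\<dots> = 1 * (\<integral>\<^sup>+u. indicator B u \<partial>chain_law N x \<alpha>) + ennreal C"
    by (rule nn_integral_affine[OF meas])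
  also have "\<dots> \<le> (\<Sum>i<N. ennreal (exp (- \<alpha>\<^sup>2 * b i * (s / (1 + s))\<^sup>2))) + ennreal C"
    using chain_law_lower_tail[OF assms(2,3,5), of N] unfolding B_def b_def by (simp add: add_right_mono)
  also have "\<dots> = ennreal ((\<Sum>i<N. exp (- \<alpha>\<^sup>2 * b i * (s / (1 + s))\<^sup>2)) + C)"
    using C_nonneg by (simp add: sum_nonneg)
  finally have "gallager_mean P N 1 x \<alpha> \<le> (\<Sum>i<N. exp (- \<alpha>\<^sup>2 * b i * (s / (1 + s))\<^sup>2)) + C"
    using C_nonneg by (subst (asm) ennreal_le_iff) (auto intro!: add_nonneg_nonneg sum_nonneg)
  then show ?thesis unfolding b_def C_def by simp
qed


text \<open>Integrating against a fixed measure moves all dependence on x and \<alpha> into the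
  integrand, where it can be handled by parametric measurability. The \<open>max 0\<close> records
  that \<open>ennreal\<close> truncates negative values of the formal density, which can occur when
  \<open>\<alpha>\<^sup>2 > 1\<close>.\<close>

lemma gallager_mean_eq_lebesgue:
  "gallager_mean P N \<rho> x \<alpha> = (\<integral>u. max 0 (\<Prod>i=1..N. trans_density \<alpha> ((u(0 := x)) (i - 1)) (u i)) * gallager P N \<rho> u
     \<partial>(\<Pi>\<^sub>M i\<in>{1..N}. lborel))"
proof -
  let ?d = "\<lambda>u :: nat \<Rightarrow> real. \<Prod>i=1..N. trans_density \<alpha> ((u(0 := x)) (i - 1)) (u i)"
  have d [measurable]: "?d \<in> borel_measurable (\<Pi>\<^sub>M i\<in>{1..N}. lborel)"
    by (rule borel_measurable_chain_density) simp_all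
  have "chain_law N x \<alpha> = density (\<Pi>\<^sub>M i\<in>{1..N}. lborel) (\<lambda>u. ennreal (max 0 (?d u)))"
    unfolding chain_law_def by (simp only: ennreal_max_0)
  then show ?thesis
    unfolding gallager_mean_def
    using integral_density[OF borel_measurable_gallager borel_measurable_max[OF d borel_measurable_const], of 0 P \<rho>]
    by (simp only: max.cobounded1 AE_I2 real_scaleR_def simp_thms)
qed

lemma borel_measurable_gallager_mean:
  "(\<lambda>p. gallager_mean P N \<rho> (fst p) (snd p)) \<in> borel_measurable (borel \<Otimes>\<^sub>M borel)"
proof -
  interpret finite_product_sigma_finite "\<lambda>_. lborel :: real measure" "{1..N}" by standard auto
  have "(\<lambda>w :: (real \<times> real) \<times> (nat \<Rightarrow> real).
      \<Prod>i=1..N. trans_density (snd (fst w)) (((snd w)(0 := fst (fst w))) (i - 1)) (snd w i))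
      \<in> borel_measurable ((borel \<Otimes>\<^sub>M borel) \<Otimes>\<^sub>M (\<Pi>\<^sub>M i\<in>{1..N}. lborel))"
    by (rule borel_measurable_chain_density) measurable
  from borel_measurable_times[OF borel_measurable_max[OF this borel_measurable_const]
      measurable_compose[OF measurable_snd borel_measurable_gallager], of 0 P \<rho>]
  show ?thesis
    unfolding gallager_mean_eq_lebesgue
    by (intro borel_measurable_lebesgue_integral) (simp only: case_prod_beta')
qed

lemma nn_integral_const_Ici:
  "0 < c \<Longrightarrow> (\<integral>\<^sup>+u. ennreal c * indicator {1::real..} u \<partial>lborel) = \<infinity>" for c :: real
proof -
  have "emeasure lborel {1::real..} = \<infinity>"
  proof (rule ccontr)
    assume "emeasure lborel {1::real..} \<noteq> \<infinity>"
    then obtain r where r: "0 \<le> r" "emeasure lborel {1::real..} = ennreal r"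
      by (cases "emeasure lborel {1::real..}") auto
    obtain n :: nat where n: "r < real n" using reals_Archimedean2 by blast
    have "ennreal (real n) = emeasure lborel {1::real..1 + real n}" by simp
    also have "\<dots> \<le> ennreal r" unfolding r(2)[symmetric] by (intro emeasure_mono) auto
    finally show False using n r(1) by simp
  qed
  then show "0 < c \<Longrightarrow> (\<integral>\<^sup>+u. ennreal c * indicator {1::real..} u \<partial>lborel) = \<infinity>"
    by (subst nn_integral_cmult_indicator) (simp_all add: ennreal_mult_top)
qed

text \<open>Outside \<open>\<bar>\<alpha>\<bar> < 1\<close> the Bochner integral is the junk value \<open>0\<close>: the formal density vanishes, is negative,
  or is not integrable. This range has probability zero, but measurability must be checked there too.\<close>

lemma gallager_mean_eq_0:
  assumes "0 < P" "0 \<le> \<rho>" "\<rho> \<le> 1" "1 \<le> \<alpha>\<^sup>2" "1 \<le> N"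
  shows "gallager_mean P N \<rho> x \<alpha> = 0"
proof -
  define D where "D u = (\<Prod>i=1..N. trans_density \<alpha> ((u(0 := x)) (i - 1)) (u i))" for u :: "nat \<Rightarrow> real"
  define G where "G u = max 0 (D u) * gallager P N \<rho> u" for u
  have G: "gallager_mean P N \<rho> x \<alpha> = (\<integral>u. G u \<partial>(\<Pi>\<^sub>M i\<in>{1..N}. lborel))"
    unfolding gallager_mean_eq_lebesgue G_def D_def ..
  have nonpos: "trans_density \<alpha> v z \<le> 0" for v z
    using assms(4) bessel_I0_ge_1[of "2 * \<alpha> * z * v / (1 - \<alpha>\<^sup>2)"] unfolding trans_density_def
    by (auto intro!: mult_nonpos_nonneg divide_nonneg_nonpos)
  have D_eq: "D u = (- 1) ^ N * (\<Prod>i=1..N. - trans_density \<alpha> ((u(0 := x)) (i - 1)) (u i))" for u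
    unfolding D_def by (simp add: prod_uminus flip: power_mult_distrib mult.assoc)
  have neg_prod: "0 \<le> (\<Prod>i=1..N. - trans_density \<alpha> ((u(0 := x)) (i - 1)) (u i))" for u
    using nonpos by (intro prod_nonneg) simp
  \<comment> \<open>Every transition factor is nonpositive here, so the product has the sign of
    \<open>(- 1) ^ N\<close>. Odd N is truncated to 0, \<open>\<alpha>\<^sup>2 = 1\<close> divides
    by zero, and even N leaves a positive density that grows too fast.\<close>
  consider "odd N" | "\<alpha>\<^sup>2 = 1" | "even N" "1 < \<alpha>\<^sup>2" using assms(4) by fastforce
  then show ?thesis
  proof cases
    case 1
    then have "D u \<le> 0" for u using neg_prod[of u] by (simp add: D_eq)
    then have "G = (\<lambda>_. 0)" by (simp add: G_def max_absorb1 fun_eq_iff)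
    then show ?thesis unfolding G by simp
  next
    case 2
    then have "D u = 0" for u
      unfolding D_def using assms(5) by (intro prod_zero) (auto simp: trans_density_def intro!: bexI[of _ 1])
    then have "G = (\<lambda>_. 0)" by (simp add: G_def fun_eq_iff)
    then show ?thesis unfolding G by simp
  next
    case 3
    define \<gamma> where "\<gamma> = \<alpha>\<^sup>2 - 1"
    have "\<gamma> > 0" using 3 by (simp add: \<gamma>_def)
    \<comment> \<open>For \<open>z \<ge> 1\<close> the bound \<open>exp t \<ge> t\<close> gives a
      density factor of modulus at least \<open>2 * z ^ 3 / \<gamma>\<^sup>2\<close>, and the
      Gallager factor is at least \<open>1 / ((1 + P) * z\<^sup>2)\<close>. Their product is
      \<open>\<kappa> * z\<close>, which is bounded below by \<open>\<kappa>\<close> on a half-line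
      of infinite length.\<close>
    define \<kappa> where "\<kappa> = 2 / \<gamma>\<^sup>2 / (1 + P)"
    have "\<kappa> > 0" using \<open>\<gamma> > 0\<close> assms(1) by (simp add: \<kappa>_def)
    have factor: "\<kappa> * indicator {1..} z \<le> - trans_density \<alpha> v z * (1 / (1 + P / (1 + \<rho>) * z\<^sup>2)) powr \<rho>" for v z
    proof (cases "1 \<le> z")
      case True
      have 1: "2 * z ^ 3 / \<gamma>\<^sup>2 \<le> - trans_density \<alpha> v z"
      proof -
        have "z\<^sup>2 / \<gamma> \<le> exp (z\<^sup>2 / \<gamma>)" using exp_ge_add_one_self[of "z\<^sup>2 / \<gamma>"] by linarith
        also have "\<dots> \<le> exp ((z\<^sup>2 + \<alpha>\<^sup>2 * v\<^sup>2) / \<gamma>)" using \<open>\<gamma> > 0\<close> by (simp add: divide_right_mono)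
        finally have "2 * z / \<gamma> * (z\<^sup>2 / \<gamma>) * 1
            \<le> 2 * z / \<gamma> * exp ((z\<^sup>2 + \<alpha>\<^sup>2 * v\<^sup>2) / \<gamma>) * bessel_I0 (2 * \<alpha> * z * v / (1 - \<alpha>\<^sup>2))"
          using True \<open>\<gamma> > 0\<close> bessel_I0_ge_1 by (intro mult_mono mult_left_mono) auto
        also have "\<dots> = - trans_density \<alpha> v z"
        proof -
          have *: "1 - \<alpha>\<^sup>2 = - \<gamma>" by (simp add: \<gamma>_def)
          have **: "(- (z\<^sup>2 + \<alpha>\<^sup>2 * v\<^sup>2)) / (- \<gamma>) = (z\<^sup>2 + \<alpha>\<^sup>2 * v\<^sup>2) / \<gamma>"
            by (metis minus_divide_left minus_divide_right minus_minus)
          show ?thesis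
            using True unfolding trans_density_def * ** by simp
        qed
        finally show ?thesis by (simp add: power2_eq_square power3_eq_cube)
      qed
      have 2: "1 / ((1 + P) * z\<^sup>2) \<le> (1 / (1 + P / (1 + \<rho>) * z\<^sup>2)) powr \<rho>"
      proof -
        have "1 \<le> z\<^sup>2" using True by (simp add: one_le_power)
        then have "1 + P * z\<^sup>2 \<le> (1 + P) * z\<^sup>2" by (simp add: distrib_right)
        then have "1 / ((1 + P) * z\<^sup>2) \<le> 1 / (1 + P * z\<^sup>2)"
          using assms(1) by (intro divide_left_mono) (auto intro!: mult_pos_pos add_pos_nonneg)
        with gallager_factor_bounds(4)[OF assms(1-3), of z] show ?thesis by linarith
      qed
      have "\<kappa> \<le> \<kappa> * z" using True \<open>\<kappa> > 0\<close> by simp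
      also have "\<dots> = 2 * z ^ 3 / \<gamma>\<^sup>2 * (1 / ((1 + P) * z\<^sup>2))"
        using True by (simp add: \<kappa>_def power2_eq_square power3_eq_cube)
      also have "\<dots> \<le> - trans_density \<alpha> v z * (1 / (1 + P / (1 + \<rho>) * z\<^sup>2)) powr \<rho>"
        using 1 2 True assms(1) nonpos[of v z] by (intro mult_mono) auto
      finally show ?thesis using True by simp
    next
      case False
      then show ?thesis using nonpos[of v z] by (simp add: mult_nonpos_nonneg)
    qed
    have ptw: "(\<Prod>i=1..N. ennreal \<kappa> * indicator {1::real..} (u i)) \<le> ennreal (G u)" for u
    proof -
      have "(\<Prod>i=1..N. \<kappa> * indicator {1..} (u i))
          \<le> (\<Prod>i=1..N. - trans_density \<alpha> ((u(0 := x)) (i - 1)) (u i) * (1 / (1 + P / (1 + \<rho>) * (u i)\<^sup>2)) powr \<rho>)"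
        using factor \<open>\<kappa> > 0\<close> by (intro prod_mono) (auto simp: indicator_def)
      also have "\<dots> = G u"
      proof -
        have "max 0 (D u) = (\<Prod>i=1..N. - trans_density \<alpha> ((u(0 := x)) (i - 1)) (u i))"
          using neg_prod[of u] 3(1) unfolding D_eq by (simp del: One_nat_def)
        then show ?thesis unfolding G_def gallager_def prod.distrib by (simp only:)
      qed
      finally have "ennreal (\<Prod>i=1..N. \<kappa> * indicator {1..} (u i)) \<le> ennreal (G u)"
        by (rule ennreal_leI)
      then show ?thesis
        using \<open>\<kappa> > 0\<close> by (simp add: prod_ennreal[symmetric] ennreal_mult' ennreal_indicator del: One_nat_def)
    qed
    have "(\<integral>\<^sup>+u. (\<Prod>i=1..N. ennreal \<kappa> * indicator {1::real..} (u i)) \<partial>(\<Pi>\<^sub>M i\<in>{1..N}. lborel))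
        = (\<Prod>i=1..N. \<integral>\<^sup>+u. ennreal \<kappa> * indicator {1::real..} u \<partial>lborel)"
      using product_sigma_finite.product_nn_integral_prod[OF product_sigma_finite_lborel, of "{1..N}"
        "\<lambda>_ u. ennreal \<kappa> * indicator {1::real..} u"] by (simp del: One_nat_def)
    also have "\<dots> = \<infinity>"
      using nn_integral_const_Ici[OF \<open>\<kappa> > 0\<close>] assms(5) by (simp add: power_eq_top_ennreal del: One_nat_def)
    finally have "(\<integral>\<^sup>+u. ennreal (G u) \<partial>(\<Pi>\<^sub>M i\<in>{1..N}. lborel)) = \<infinity>"
      using nn_integral_mono[of "\<Pi>\<^sub>M i\<in>{1..N}. lborel" "\<lambda>u. \<Prod>i=1..N. ennreal \<kappa> * indicator {1::real..} (u i)"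
        "\<lambda>u. ennreal (G u)", OF ptw] by (simp add: top_unique del: One_nat_def)
    then have "\<not> integrable (\<Pi>\<^sub>M i\<in>{1..N}. lborel) G"
    proof -
      have "0 \<le> G u" for u
        unfolding G_def gallager_def by (intro mult_nonneg_nonneg prod_nonneg) auto
      then show ?thesis
        using \<open>(\<integral>\<^sup>+u. ennreal (G u) \<partial>(\<Pi>\<^sub>M i\<in>{1..N}. lborel)) = \<infinity>\<close> by (auto simp: integrable_iff_bounded)
    qed
    then show ?thesis unfolding G by (rule not_integrable_integral_eq)
  qed
qed

section \<open>Bounds on the throughput at fixed block length and rate\<close>

lemma exp_error_exponent:
  assumes "0 < P" "0 \<le> \<rho>" "\<rho> \<le> 1" "\<alpha>\<^sup>2 < 1" "1 \<le> N"
  shows "exp (- real N * (error_exponent P N \<rho> x \<alpha> - \<rho> * R)) = exp (real N * \<rho> * R) * gallager_mean P N \<rho> x \<alpha>"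
proof -
  have "error_exponent P N \<rho> x \<alpha> = - (1 / real N) * ln (gallager_mean P N \<rho> x \<alpha>)"
    unfolding error_exponent_def gallager_mean_def gallager_def ..
  then have "- real N * (error_exponent P N \<rho> x \<alpha> - \<rho> * R) = real N * \<rho> * R + ln (gallager_mean P N \<rho> x \<alpha>)"
    using assms(5) by (simp add: field_simps)
  then show ?thesis
    using gallager_mean_pos[OF assms(1-4), of N x] by (simp add: exp_add)
qed

lemma throughput_eq:
  assumes "0 < P" "\<alpha>\<^sup>2 < 1" "1 \<le> N"
  shows "throughput P x \<alpha> N R = R * (1 - (INF \<rho>\<in>{0..1}. exp (real N * \<rho> * R) * gallager_mean P N \<rho> x \<alpha>))"
proof -
  have "(INF \<rho>\<in>{0..1}. exp (- real N * (error_exponent P N \<rho> x \<alpha> - \<rho> * R)))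
      = (INF \<rho>\<in>{0..1}. exp (real N * \<rho> * R) * gallager_mean P N \<rho> x \<alpha>)"
    by (rule INF_cong[OF refl], rule exp_error_exponent) (use assms in auto)
  then show ?thesis unfolding throughput_def by simp
qed

lemma throughput_eq_0:
  assumes "0 < P" "1 \<le> \<alpha>\<^sup>2" "1 \<le> N" "0 \<le> R"
  shows "throughput P x \<alpha> N R = 0"
proof -
  \<comment> \<open>Since \<open>ln 0 = 0\<close>, a vanishing mean yields exponent 0; the infimum
    is then 1, attained at \<open>\<rho> = 0\<close>.\<close>
  have "error_exponent P N \<rho> x \<alpha> = 0" if "\<rho> \<in> {0..1}" for \<rho>
    using gallager_mean_eq_0[of P \<rho> \<alpha> N x] assms that
    unfolding error_exponent_def gallager_mean_def gallager_def by simp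
  then have "(INF \<rho>\<in>{0..1}. exp (- real N * (error_exponent P N \<rho> x \<alpha> - \<rho> * R))) = (INF \<rho>\<in>{0..1}. exp (real N * \<rho> * R))"
    by (intro INF_cong) (auto simp: mult_ac)
  also have "\<dots> = 1"
    using assms(4) by (intro cInf_eq_minimum) (auto intro: rev_image_eqI[of 0])
  finally show ?thesis unfolding throughput_def by simp
qed

lemma throughput_ge:
  assumes "0 < P" "\<alpha>\<^sup>2 < 1" "1 \<le> N" "0 \<le> R" "\<rho> \<in> {0..1}"
  shows "R * (1 - exp (real N * \<rho> * R) * gallager_mean P N \<rho> x \<alpha>) \<le> throughput P x \<alpha> N R"
proof -
  have "(INF \<rho>\<in>{0..1}. exp (real N * \<rho> * R) * gallager_mean P N \<rho> x \<alpha>) \<le> exp (real N * \<rho> * R) * gallager_mean P N \<rho> x \<alpha>"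
  proof (rule cINF_lower)
    show "bdd_below ((\<lambda>\<rho>. exp (real N * \<rho> * R) * gallager_mean P N \<rho> x \<alpha>) ` {0..1})"
      using gallager_mean_pos[OF assms(1) _ _ assms(2), of _ N x]
      by (intro bdd_belowI2[where m = 0]) (auto simp: less_imp_le)
  qed fact
  then show ?thesis
    unfolding throughput_eq[OF assms(1-3)] using assms(4) by (intro mult_left_mono) auto
qed

text \<open>The block average of the capacity at the mean received power, an upper bound on the mean
  mutual information. It plays the role of the capacity in the converse.\<close>

definition jensen_rate :: "real \<Rightarrow> nat \<Rightarrow> real \<Rightarrow> real \<Rightarrow> real" where
  "jensen_rate P N x \<alpha> = (\<Sum>i=1..N. ln (1 + P * ((\<alpha>\<^sup>2) ^ i * x\<^sup>2 + (1 - (\<alpha>\<^sup>2) ^ i)))) / real N"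

text \<open>After the Jensen bound, the quantity under the infimum is at least
  \<open>exp (\<rho> * t)\<close> with t independent of \<rho>. This is monotone in \<rho>, so its
  minimum over the unit interval is at an endpoint, 1 or \<open>exp t\<close>.\<close>

lemma throughput_le:
  assumes "0 < P" "\<alpha>\<^sup>2 < 1" "1 \<le> N" "0 \<le> R"
  shows "throughput P x \<alpha> N R \<le> R * (1 - min 1 (exp (- real N * (jensen_rate P N x \<alpha> - R))))"
proof -
  define C where "C = jensen_rate P N x \<alpha>"
  have "min 1 (exp (- real N * (C - R))) \<le> (INF \<rho>\<in>{0..1}. exp (real N * \<rho> * R) * gallager_mean P N \<rho> x \<alpha>)"
  proof (rule cINF_greatest)
    fix \<rho> :: real assume \<rho>: "\<rho> \<in> {0..1}"
    have "exp (- \<rho> * (real N * C)) \<le> gallager_mean P N \<rho> x \<alpha>"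
      using gallager_mean_lower[OF assms(1) _ _ assms(2), of \<rho> x N] \<rho> assms(3) by (simp add: C_def jensen_rate_def)
    then have "exp (real N * \<rho> * R) * exp (- \<rho> * (real N * C)) \<le> exp (real N * \<rho> * R) * gallager_mean P N \<rho> x \<alpha>"
      by (intro mult_left_mono) auto
    moreover have "exp (real N * \<rho> * R) * exp (- \<rho> * (real N * C)) = exp (\<rho> * (- real N * (C - R)))"
      by (simp add: mult_exp_exp algebra_simps)
    moreover have "min 1 (exp (- real N * (C - R))) \<le> exp (\<rho> * (- real N * (C - R)))"
    proof (cases "0 \<le> - real N * (C - R)")
      case True
      have "0 \<le> \<rho>" using \<rho> by simp
      from mult_nonneg_nonneg[OF this True] have "0 \<le> \<rho> * (- real N * (C - R))" .
      then show ?thesis by (intro min.coboundedI1) (simp only: one_le_exp_iff)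
    next
      case False
      then have "- real N * (C - R) \<le> \<rho> * (- real N * (C - R))"
        using \<rho> mult_right_mono_neg[of \<rho> 1 "- real N * (C - R)"] by simp
      then show ?thesis by (intro min.coboundedI2) (simp only: exp_le_cancel_iff)
    qed
    ultimately show "min 1 (exp (- real N * (C - R))) \<le> exp (real N * \<rho> * R) * gallager_mean P N \<rho> x \<alpha>" by linarith
  qed simp
  then show ?thesis
    unfolding throughput_eq[OF assms(1-3)] C_def using assms(4) by (intro mult_left_mono) auto
qed


section \<open>Optimized throughput of one user\<close>

definition best_throughput :: "real \<Rightarrow> real \<Rightarrow> real \<Rightarrow> real" where
  "best_throughput P x \<alpha> = (SUP (N, R)\<in>{1..} \<times> {0..}. throughput P x \<alpha> N R)"

lemma jensen_rate_le:
  assumes "0 < P" "\<alpha>\<^sup>2 < 1" "1 \<le> N"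
  shows "jensen_rate P N x \<alpha> \<le> ln (1 + P * (x\<^sup>2 + 1))"
proof -
  have "(\<Sum>i=1..N. ln (1 + P * ((\<alpha>\<^sup>2) ^ i * x\<^sup>2 + (1 - (\<alpha>\<^sup>2) ^ i)))) \<le> (\<Sum>i=1..N. ln (1 + P * (x\<^sup>2 + 1)))"
  proof (rule sum_mono)
    fix i :: nat
    have p: "0 \<le> (\<alpha>\<^sup>2) ^ i" "(\<alpha>\<^sup>2) ^ i \<le> 1" using assms(2) by (auto intro: power_le_one)
    then have "(\<alpha>\<^sup>2) ^ i * x\<^sup>2 + (1 - (\<alpha>\<^sup>2) ^ i) \<le> 1 * x\<^sup>2 + 1"
      by (intro add_mono mult_right_mono) auto
    moreover have "0 \<le> (\<alpha>\<^sup>2) ^ i * x\<^sup>2 + (1 - (\<alpha>\<^sup>2) ^ i)" using p by simp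
    ultimately show "ln (1 + P * ((\<alpha>\<^sup>2) ^ i * x\<^sup>2 + (1 - (\<alpha>\<^sup>2) ^ i))) \<le> ln (1 + P * (x\<^sup>2 + 1))"
      using assms(1) by (intro ln_mono) (auto intro: add_pos_nonneg)
  qed
  then show ?thesis
    using assms(3) unfolding jensen_rate_def by (simp add: divide_le_eq mult.commute)
qed

text \<open>Below the Jensen rate R itself obeys the bound; above it the error bound reaches 1 and
  the throughput is nonpositive. Boundedness is what makes the real supremum in
  \<open>best_throughput\<close> meaningful.\<close>

lemma throughput_bounded:
  assumes "0 < P" "\<alpha>\<^sup>2 < 1" "1 \<le> N" "0 \<le> R"
  shows "throughput P x \<alpha> N R \<le> ln (1 + P * (x\<^sup>2 + 1))"
proof (cases "R \<le> jensen_rate P N x \<alpha>")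
  case True
  have "throughput P x \<alpha> N R \<le> R * (1 - min 1 (exp (- real N * (jensen_rate P N x \<alpha> - R))))"
    by (rule throughput_le[OF assms])
  also have "\<dots> \<le> R * 1" using assms(4) by (intro mult_left_mono) auto
  also have "\<dots> \<le> ln (1 + P * (x\<^sup>2 + 1))" using True jensen_rate_le[OF assms(1-3), of x] by simp
  finally show ?thesis .
next
  case False
  then have "1 \<le> exp (- real N * (jensen_rate P N x \<alpha> - R))"
    using assms(3) by (simp add: mult_nonneg_nonpos)
  then have "throughput P x \<alpha> N R \<le> 0"
    using throughput_le[OF assms, of x] by simp
  also have "0 \<le> ln (1 + P * (x\<^sup>2 + 1))" using assms(1) by simp
  finally show ?thesis .
qed

lemma bdd_above_throughput:
  assumes "0 < P" "\<alpha>\<^sup>2 < 1"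
  shows "bdd_above ((\<lambda>(N, R). throughput P x \<alpha> N R) ` ({1..} \<times> {0..}))"
  using throughput_bounded[OF assms] by (intro bdd_aboveI2[where M = "ln (1 + P * (x\<^sup>2 + 1))"]) auto

lemma throughput_le_best:
  assumes "0 < P" "\<alpha>\<^sup>2 < 1" "1 \<le> N" "0 \<le> R"
  shows "throughput P x \<alpha> N R \<le> best_throughput P x \<alpha>"
  unfolding best_throughput_def
  using cSUP_upper[OF _ bdd_above_throughput[OF assms(1,2)], of "(N, R)" x] assms by auto

lemma best_throughput_le:
  assumes "\<And>N R. 1 \<le> N \<Longrightarrow> 0 \<le> R \<Longrightarrow> throughput P x \<alpha> N R \<le> B"
  shows "best_throughput P x \<alpha> \<le> B"
  unfolding best_throughput_def using assms by (intro cSUP_least) auto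

lemma best_throughput_nonneg:
  assumes "0 < P" "\<alpha>\<^sup>2 < 1"
  shows "0 \<le> best_throughput P x \<alpha>"
  using throughput_le_best[OF assms, of 1 0 x] by (simp add: throughput_def)

lemma best_throughput_eq_0:
  assumes "0 < P" "1 \<le> \<alpha>\<^sup>2"
  shows "best_throughput P x \<alpha> = 0"
proof -
  have "best_throughput P x \<alpha> = (SUP (N, R)\<in>{1 :: nat..} \<times> {0 :: real..}. 0)"
    unfolding best_throughput_def using throughput_eq_0[OF assms] by (intro SUP_cong) auto
  also have "\<dots> = 0" by (simp add: case_prod_beta')
  finally show ?thesis .
qed

text \<open>The supremum over the rate and the infimum over \<open>\<rho>\<close> become one supremum of functions that are continuous
  in \<open>(R, \<rho>)\<close>; it may therefore be taken over a countable dense set, which makes it measurable.\<close>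

lemma borel_measurable_best_throughput:
  assumes "0 < P"
  shows "(\<lambda>p. best_throughput P (fst p) (snd p)) \<in> borel_measurable (borel \<Otimes>\<^sub>M borel)"
proof -
  define X where "X = {0::real..} \<times> {0..1::real}"
  obtain D where D: "countable D" "D \<subseteq> X" "X \<subseteq> closure D"
    using separable[of X] by blast
  have "closed X" unfolding X_def by (intro closed_Times) auto
  then have closure_D: "closure D = X"
    using D closure_minimal by blast
  have "D \<noteq> {}" using D(3) by (auto simp: X_def)
  \<comment> \<open>The throughput before minimizing over \<rho>, with
    \<open>q = (R, \<rho>)\<close>. The minus sign turns the infimum over \<rho> into a supremum,
    which merges with the one over R.\<close>
  define f where "f x \<alpha> = (\<lambda>(N, q). fst q * (1 - exp (real N * snd q * fst q) * gallager_mean P N (snd q) x \<alpha>))"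
    for x \<alpha> :: real
  define I where "I = {1::nat..} \<times> D"
  have "countable I" "I \<noteq> {}"
    using D(1) \<open>D \<noteq> {}\<close> by (auto simp: I_def)
  \<comment> \<open>Continuity in \<rho> and the comparison with the throughput are available only
    for \<open>\<alpha>\<^sup>2 < 1\<close>; elsewhere the supremum is known to be 0, so the family
    is cut off there.\<close>
  define g where "g i p = (if (snd p)\<^sup>2 < 1 then f (fst p) (snd p) i else 0)" for i and p :: "real \<times> real"
  have f_le_throughput: "f x \<alpha> (N, (R, \<rho>)) \<le> throughput P x \<alpha> N R"
    if "\<alpha>\<^sup>2 < 1" "1 \<le> N" "(R, \<rho>) \<in> X" for x \<alpha> N R \<rho>
    using throughput_ge[OF assms that(1,2), of R \<rho> x] that(3) by (simp add: f_def X_def mult.assoc)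
  have bound: "f x \<alpha> i \<le> best_throughput P x \<alpha>" if "\<alpha>\<^sup>2 < 1" "i \<in> I" for x \<alpha> i
  proof -
    obtain N R \<rho> where i: "i = (N, (R, \<rho>))" by (metis prod.exhaust)
    then have "1 \<le> N" "(R, \<rho>) \<in> X" using that(2) D(2) by (auto simp: I_def)
    then show ?thesis
      using f_le_throughput[OF that(1), of N R \<rho> x] throughput_le_best[OF assms that(1), of N R x]
      unfolding i by (auto simp: X_def)
  qed
  have eq: "best_throughput P (fst p) (snd p) = (SUP i\<in>I. g i p)" for p
  proof (cases "(snd p)\<^sup>2 < 1")
    case True
    define x \<alpha> where "x = fst p" and "\<alpha> = snd p"
    have \<alpha>: "\<alpha>\<^sup>2 < 1" using True by (simp add: \<alpha>_def)
    have bdd: "bdd_above (f x \<alpha> ` I)"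
      using bound[OF \<alpha>] by (intro bdd_aboveI2[where M = "best_throughput P x \<alpha>"]) auto
    have "best_throughput P x \<alpha> = (SUP i\<in>I. f x \<alpha> i)"
    proof (rule antisym)
      show "(SUP i\<in>I. f x \<alpha> i) \<le> best_throughput P x \<alpha>"
        using bound[OF \<alpha>] \<open>I \<noteq> {}\<close> by (intro cSUP_least) auto
      show "best_throughput P x \<alpha> \<le> (SUP i\<in>I. f x \<alpha> i)"
      proof (rule best_throughput_le)
        fix N :: nat and R :: real assume N: "1 \<le> N" and R: "0 \<le> R"
        have cont: "continuous_on X (\<lambda>q. f x \<alpha> (N, q))"
          unfolding f_def X_def case_prod_conv
          by (intro continuous_intros continuous_on_compose2[OF continuous_on_gallager_mean[OF assms \<alpha>]]) auto
        have sup: "f x \<alpha> (N, (R, \<rho>)) \<le> (SUP i\<in>I. f x \<alpha> i)" if "\<rho> \<in> {0..1}" for \<rho>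
        proof (rule continuous_le_on_closure[where S = D and f = "\<lambda>q. f x \<alpha> (N, q)"])
          show "continuous_on (closure D) (\<lambda>q. f x \<alpha> (N, q))" unfolding closure_D by (rule cont)
          show "(R, \<rho>) \<in> closure D" unfolding closure_D using R that by (simp add: X_def)
          show "f x \<alpha> (N, q) \<le> (SUP i\<in>I. f x \<alpha> i)" if "q \<in> D" for q
            using that N by (intro cSUP_upper bdd) (auto simp: I_def)
        qed
        show "throughput P x \<alpha> N R \<le> (SUP i\<in>I. f x \<alpha> i)"
        proof (cases "R = 0")
          case True
          then show ?thesis using sup[of 0] by (simp add: throughput_def f_def)
        next
          case False
          then have "0 < R" using R by simp
          \<comment> \<open>Dividing by R isolates the term under the infimum; this is why
            \<open>R = 0\<close> is a case of its own.\<close>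
          have "1 - (SUP i\<in>I. f x \<alpha> i) / R \<le> (INF \<rho>\<in>{0..1}. exp (real N * \<rho> * R) * gallager_mean P N \<rho> x \<alpha>)"
          proof (rule cINF_greatest)
            fix \<rho> :: real assume "\<rho> \<in> {0..1}"
            from sup[OF this] have "1 - exp (real N * \<rho> * R) * gallager_mean P N \<rho> x \<alpha> \<le> (SUP i\<in>I. f x \<alpha> i) / R"
              using \<open>0 < R\<close> by (simp add: f_def pos_le_divide_eq mult.commute)
            then show "1 - (SUP i\<in>I. f x \<alpha> i) / R \<le> exp (real N * \<rho> * R) * gallager_mean P N \<rho> x \<alpha>"
              by linarith
          qed simp
          then have "1 - (INF \<rho>\<in>{0..1}. exp (real N * \<rho> * R) * gallager_mean P N \<rho> x \<alpha>) \<le> (SUP i\<in>I. f x \<alpha> i) / R"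
            by linarith
          then show ?thesis
            unfolding throughput_eq[OF assms \<alpha> N] using \<open>0 < R\<close> by (simp add: pos_le_divide_eq mult.commute)
        qed
      qed
    qed
    then show ?thesis
      using True unfolding g_def x_def \<alpha>_def by simp
  next
    case False
    then show ?thesis
      using best_throughput_eq_0[OF assms, of "snd p" "fst p"] \<open>I \<noteq> {}\<close> by (simp add: g_def)
  qed
  have "(\<lambda>p. SUP i\<in>I. g i p) \<in> borel_measurable (borel \<Otimes>\<^sub>M borel)"
  proof (rule borel_measurable_cSUP[OF \<open>countable I\<close>])
    fix i :: "nat \<times> real \<times> real"
    obtain N R \<rho> where i: "i = (N, (R, \<rho>))" by (metis prod.exhaust)
    note borel_measurable_gallager_mean[measurable]
    show "g i \<in> borel_measurable (borel \<Otimes>\<^sub>M borel)"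
      unfolding g_def[abs_def] f_def i by simp
  next
    fix p :: "real \<times> real"
    show "bdd_above ((\<lambda>i. g i p) ` I)"
      using bound[of "snd p" _ "fst p"]
      by (intro bdd_aboveI2[where M = "max 0 (best_throughput P (fst p) (snd p))"]) (auto simp: g_def le_max_iff_disj)
  qed
  then show ?thesis unfolding eq .
qed

text \<open>The mean power is at most of the order of \<open>exp (max 0 (Y - 2 * i * l))\<close>,
  which bounds each logarithm up to the constant \<open>ln (2 * (1 + P))\<close>. Averaging a linear
  decay over the block costs at least \<open>N * l\<close>; once the decay saturates at power of
  order 1, it still costs at least \<open>Y / 2\<close>.\<close>

lemma jensen_rate_le_drift:
  assumes "0 < P" "0 < \<alpha>" "\<alpha> < 1" "1 \<le> N" "0 \<le> Y" "x\<^sup>2 \<le> exp Y"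
  shows "jensen_rate P N x \<alpha> \<le> ln (2 * (1 + P)) + Y - min (real N * ln (1 / \<alpha>)) (Y / 2)"
proof -
  define l where "l = ln (1 / \<alpha>)"
  have "0 < l" using assms by (simp add: l_def)
  have \<alpha>: "\<alpha>\<^sup>2 = exp (- 2 * l)"
  proof -
    have "\<alpha> = exp (- l)" using assms by (simp add: l_def ln_div)
    then show ?thesis by (simp add: power2_eq_square mult_exp_exp)
  qed
  \<comment> \<open>The loss \<open>min (2 * i * l) Y\<close> is concave in i and so lies above its
    chord from 0 to N + 1, where it equals M. Ending the chord at N + 1 makes the average of
    \<open>i / (N + 1)\<close> over the block exactly 1/2.\<close>
  define M where "M = min (2 * (real N + 1) * l) Y"
  have "(\<Sum>i=1..N. ln (1 + P * ((\<alpha>\<^sup>2) ^ i * x\<^sup>2 + (1 - (\<alpha>\<^sup>2) ^ i))))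
      \<le> (\<Sum>i=1..N. ln (2 * (1 + P)) + Y - real i / (real N + 1) * M)"
  proof (rule sum_mono)
    fix i assume i: "i \<in> {1..N}"
    have pw: "(\<alpha>\<^sup>2) ^ i = exp (- 2 * real i * l)" unfolding \<alpha> by (simp add: exp_of_nat_mult[symmetric] mult_ac)
    define E where "E = exp (max 0 (Y - 2 * real i * l))"
    have "(\<alpha>\<^sup>2) ^ i * x\<^sup>2 \<le> exp (- 2 * real i * l) * exp Y"
      unfolding pw using assms(6) by (intro mult_left_mono) auto
    also have "\<dots> \<le> E" by (simp add: E_def mult_exp_exp)
    finally have "(\<alpha>\<^sup>2) ^ i * x\<^sup>2 \<le> E" .
    moreover have "1 \<le> E" by (simp add: E_def)
    moreover have "(\<alpha>\<^sup>2) ^ i \<ge> 0" "(\<alpha>\<^sup>2) ^ i \<le> 1" using \<open>0 < l\<close> unfolding pw by simp_all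
    moreover have "1 - (\<alpha>\<^sup>2) ^ i \<le> E" using calculation by linarith
    ultimately have "1 + P * ((\<alpha>\<^sup>2) ^ i * x\<^sup>2 + (1 - (\<alpha>\<^sup>2) ^ i)) \<le> E + P * (E + E)"
      using assms(1) by (intro add_mono mult_left_mono) auto
    also have "\<dots> \<le> 2 * (1 + P) * E" using assms(1) by (simp add: algebra_simps E_def)
    finally have "ln (1 + P * ((\<alpha>\<^sup>2) ^ i * x\<^sup>2 + (1 - (\<alpha>\<^sup>2) ^ i))) \<le> ln (2 * (1 + P) * E)"
      using assms(1) \<open>(\<alpha>\<^sup>2) ^ i \<le> 1\<close> \<open>(\<alpha>\<^sup>2) ^ i \<ge> 0\<close> by (intro ln_mono) (auto intro!: add_pos_nonneg)
    also have "\<dots> = ln (2 * (1 + P)) + max 0 (Y - 2 * real i * l)"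
      using assms(1) by (simp add: ln_mult E_def)
    also have "max 0 (Y - 2 * real i * l) \<le> Y - real i / (real N + 1) * M"
    proof -
      have "real i / (real N + 1) * M \<le> real i / (real N + 1) * (2 * (real N + 1) * l)"
        by (intro mult_left_mono) (auto simp: M_def)
      also have "\<dots> = 2 * real i * l" by (simp add: field_simps)
      finally have "real i / (real N + 1) * M \<le> 2 * real i * l" .
      moreover have "real i / (real N + 1) * M \<le> 1 * Y"
        using i assms(5) \<open>0 < l\<close> by (intro mult_mono) (auto simp: M_def)
      ultimately show ?thesis by simp
    qed
    finally show "ln (1 + P * ((\<alpha>\<^sup>2) ^ i * x\<^sup>2 + (1 - (\<alpha>\<^sup>2) ^ i))) \<le> ln (2 * (1 + P)) + Y - real i / (real N + 1) * M"
      by simp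
  qed
  also have "\<dots> = real N * (ln (2 * (1 + P)) + Y) - (\<Sum>i=1..N. real i) / (real N + 1) * M"
    by (simp add: sum_subtractf sum_distrib_right sum_divide_distrib)
  also have "(\<Sum>i=1..N. real i) = real N * (real N + 1) / 2"
    by (induction N) (simp_all add: field_simps)
  also have "real N * (ln (2 * (1 + P)) + Y) - real N * (real N + 1) / 2 / (real N + 1) * M
      = real N * (ln (2 * (1 + P)) + Y - M / 2)"
    by (simp add: field_simps)
  finally have "jensen_rate P N x \<alpha> \<le> ln (2 * (1 + P)) + Y - M / 2"
    unfolding jensen_rate_def using assms(4) by (simp add: divide_le_eq mult.commute)
  moreover have "min (real N * l) (Y / 2) \<le> M / 2"
    using \<open>0 < l\<close> by (auto simp: M_def min_def field_simps)
  ultimately show ?thesis unfolding l_def by linarith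
qed

text \<open>A block of length \<open>N\<close> loses \<open>N l\<close> by the decay of the fading gain and about \<open>(ln Y) / N\<close> by the rate backoff
  that keeps the error probability below \<open>1 / Y\<close>; the sum is at least \<open>2 sqrt (l ln Y)\<close>.\<close>

lemma throughput_le_tradeoff:
  assumes "0 < P" "0 < \<alpha>" "\<alpha> < 1" "1 \<le> N" "0 \<le> R" "2 \<le> Y" "x\<^sup>2 \<le> exp Y"
  shows "throughput P x \<alpha> N R \<le> ln (2 * (1 + P)) + Y - min (2 * sqrt (ln (1 / \<alpha>) * ln (Y / 2))) (Y / 2)"
proof -
  define l c w C where "l = ln (1 / \<alpha>)" and "c = ln (2 * (1 + P))" and "w = ln (Y / 2)"
    and "C = jensen_rate P N x \<alpha>"
  have l: "0 < l" using assms by (simp add: l_def)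
  have c: "0 \<le> c" using assms(1) by (simp add: c_def)
  have w: "0 \<le> w" using assms(6) by (simp add: w_def)
  have \<alpha>2: "\<alpha>\<^sup>2 < 1" using assms(2,3) by (simp add: power_less_one_iff abs_square_less_1)
  have T: "throughput P x \<alpha> N R \<le> R * (1 - min 1 (exp (- real N * (C - R))))"
    unfolding C_def by (rule throughput_le[OF assms(1) \<alpha>2 assms(4,5)])
  have T_le_R: "throughput P x \<alpha> N R \<le> R"
    using T mult_left_mono[of "1 - min 1 (exp (- real N * (C - R)))" 1 R] assms(5) by simp
  have C: "C \<le> c + Y - min (real N * l) (Y / 2)"
    unfolding C_def c_def l_def by (rule jensen_rate_le_drift) (use assms in auto)
  \<comment> \<open>The first three cases need no tradeoff: the throughput is at most
    \<open>R \<le> Y / 2\<close>, or nonpositive above the Jensen rate, or the decay alone costs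
    \<open>Y / 2\<close>. In the last case \<open>R > Y / 2\<close> prices the error bound
    \<open>exp (- N * \<delta>)\<close> at no less than
    \<open>exp (w - N * \<delta>)\<close>.\<close>
  consider "R \<le> Y / 2" | "R > C" | "R \<le> C" "Y / 2 \<le> real N * l" | "R \<le> C" "Y / 2 < R" "real N * l \<le> Y / 2"
    by linarith
  then have "throughput P x \<alpha> N R \<le> c + Y - min (2 * sqrt (l * w)) (Y / 2)"
  proof cases
    case 1
    then show ?thesis using T_le_R c by linarith
  next
    case 2
    then have "1 \<le> exp (- real N * (C - R))"
      using assms(4) by (simp add: mult_nonneg_nonpos)
    then have "throughput P x \<alpha> N R \<le> 0" using T by simp
    then show ?thesis using c assms(6) by linarith
  next
    case 3
    then show ?thesis using T_le_R C c by linarith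
  next
    case 4
    define \<delta> where "\<delta> = C - R"
    have \<delta>: "0 \<le> \<delta>" using 4 by (simp add: \<delta>_def)
    have "exp (- real N * \<delta>) \<le> 1" using \<delta> by simp
    then have "throughput P x \<alpha> N R \<le> R * (1 - exp (- real N * \<delta>))"
      using T by (simp add: \<delta>_def min_absorb2)
    also have "\<dots> \<le> R - Y / 2 * exp (- real N * \<delta>)"
      using 4 by (simp add: algebra_simps)
    also have "Y / 2 * exp (- real N * \<delta>) = exp (w - real N * \<delta>)"
      using assms(6) by (simp add: w_def exp_diff exp_minus field_simps)
    finally have T': "throughput P x \<alpha> N R \<le> C - \<delta> - exp (w - real N * \<delta>)"
      by (simp add: \<delta>_def)
    \<comment> \<open>No backoff \<delta> beats \<open>w / N\<close>: for a smaller one,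
      \<open>t = w - N * \<delta>\<close> is positive and the saving \<open>t / N\<close> is
      outweighed by \<open>exp t \<ge> t\<close>.\<close>
    have "w / real N \<le> \<delta> + exp (w - real N * \<delta>)"
    proof (cases "w \<le> real N * \<delta>")
      case True
      then have "w / real N \<le> \<delta>" using assms(4) by (simp add: divide_le_eq mult.commute)
      then show ?thesis using exp_ge_zero[of "w - real N * \<delta>"] by linarith
    next
      case False
      have "(w - real N * \<delta>) / real N \<le> (w - real N * \<delta>) / 1"
        using False assms(4) by (intro divide_left_mono) auto
      also have "\<dots> \<le> exp (w - real N * \<delta>)"
        using exp_ge_add_one_self[of "w - real N * \<delta>"] unfolding div_by_1 by linarith
      finally have "(w - real N * \<delta>) / real N \<le> exp (w - real N * \<delta>)" .
      then show ?thesis using assms(4) by (simp add: diff_divide_distrib)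
    qed
    moreover have "2 * sqrt (l * w) \<le> real N * l + w / real N"
    proof -
      have "sqrt ((real N * l) * (w / real N)) \<le> (real N * l + w / real N) / 2"
        using l w by (intro arith_geo_mean_sqrt) auto
      moreover have "(real N * l) * (w / real N) = l * w" using assms(4) by simp
      ultimately show ?thesis by simp
    qed
    ultimately show ?thesis using T' C 4 by linarith
  qed
  then show ?thesis unfolding l_def c_def w_def .
qed

text \<open>Y is a deterministic level, while the random gain may exceed \<open>exp Y\<close>.
  Working with Z, the larger of Y and the actual log-power, makes the tradeoff applicable; the
  excess over Y is at most \<open>x\<^sup>2 / exp Y\<close>, which has bounded mean at the level
  used later.\<close>

lemma best_throughput_upper:
  assumes "0 < P" "0 < \<alpha>" "\<alpha> < 1" "2 \<le> Y"
  shows "best_throughput P x \<alpha> \<le> ln (2 * (1 + P)) + Y + x\<^sup>2 / exp Y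
    - 2 * sqrt (ln (Y / 2)) * sqrt (ln (inverse \<alpha>)) + 2 * ln (inverse \<alpha>)"
proof (rule best_throughput_le)
  fix N :: nat and R :: real assume NR: "1 \<le> N" "0 \<le> R"
  define l w Z where "l = ln (1 / \<alpha>)" and "w = ln (Y / 2)" and "Z = ln (max (x\<^sup>2) (exp Y))"
  have l: "0 < l" using assms by (simp add: l_def)
  have "w \<le> Y / 2 - 1" using assms(4) by (simp add: w_def ln_le_minus_one)
  have w: "0 \<le> w" using assms(4) by (simp add: w_def)
  have m: "0 < max (x\<^sup>2) (exp Y)" by (simp add: less_max_iff_disj)
  have YZ: "Y \<le> Z" using m unfolding Z_def by (subst ln_ge_iff) auto
  have xZ: "x\<^sup>2 \<le> exp Z" using m by (simp add: Z_def)
  have ZY: "Z \<le> Y + x\<^sup>2 / exp Y"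
  proof -
    have "Z - Y = ln (max (x\<^sup>2) (exp Y) / exp Y)"
      using m by (simp add: Z_def ln_div)
    also have "\<dots> \<le> max (x\<^sup>2) (exp Y) / exp Y - 1" using m by (intro ln_le_minus_one) auto
    also have "\<dots> \<le> x\<^sup>2 / exp Y" by (auto simp: max_def field_simps)
    finally show ?thesis by simp
  qed
  \<comment> \<open>The alternative \<open>Z / 2\<close> in the minimum matters only for large l.
    Weighting the arithmetic-geometric mean inequality as \<open>2 * l + w / 2\<close> shows that
    \<open>2 * l\<close> pays for it.\<close>
  have "2 * sqrt (l * w) - 2 * l \<le> min (2 * sqrt (l * ln (Z / 2))) (Z / 2)"
  proof -
    have "ln (Y / 2) \<le> ln (Z / 2)" using YZ assms(4) by (intro ln_mono) auto
    then have "sqrt (l * w) \<le> sqrt (l * ln (Z / 2))"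
      using l unfolding w_def by simp
    moreover have "2 * sqrt (l * w) \<le> 2 * l + w / 2"
      using arith_geo_mean_sqrt[of "2 * l" "w / 2"] l w by simp
    ultimately show ?thesis
      using l \<open>w \<le> Y / 2 - 1\<close> w YZ by (intro min.boundedI) linarith+
  qed
  moreover have "throughput P x \<alpha> N R \<le> ln (2 * (1 + P)) + Z - min (2 * sqrt (l * ln (Z / 2))) (Z / 2)"
    unfolding l_def using YZ xZ assms NR by (intro throughput_le_tradeoff) auto
  ultimately have "throughput P x \<alpha> N R \<le> ln (2 * (1 + P)) + Y + x\<^sup>2 / exp Y - 2 * sqrt (l * w) + 2 * l"
    using ZY by linarith
  then show "throughput P x \<alpha> N R \<le> ln (2 * (1 + P)) + Y + x\<^sup>2 / exp Y
    - 2 * sqrt (ln (Y / 2)) * sqrt (ln (inverse \<alpha>)) + 2 * ln (inverse \<alpha>)"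
    by (simp add: l_def w_def real_sqrt_mult inverse_eq_divide mult_ac)
qed


section \<open>Achievability for a single user\<close>

lemma achievability_conditions:
  assumes "0 < P"
  shows "\<forall>\<^sub>F L :: real in at_top. 0 < L \<and> 1 \<le> ln L \<and> 2 * sqrt (L / 16 * ln L) + 2 + L / 8 \<le> L / 2
    \<and> (ln L + 3)\<^sup>2 * ((ln L + 2) * L + ln L + 2) \<le> exp (L / 2 - 2) / P"
proof (intro eventually_conj)
  show "\<forall>\<^sub>F L :: real in at_top. 0 < L" by real_asymp
  show "\<forall>\<^sub>F L :: real in at_top. 1 \<le> ln L" by real_asymp
  \<comment> \<open>For \<open>l \<le> L / 16\<close> this yields
    \<open>2 * N * l \<le> L / 2\<close>, so the decay over the block consumes at most half of
    L.\<close>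
  show "\<forall>\<^sub>F L :: real in at_top. 2 * sqrt (L / 16 * ln L) + 2 + L / 8 \<le> L / 2" by real_asymp
  \<comment> \<open>The requirement of \<open>gallager_mean_decay\<close> with N replaced by its
    upper bound \<open>ln L + 2\<close>.\<close>
  show "\<forall>\<^sub>F L :: real in at_top. (ln L + 3)\<^sup>2 * ((ln L + 2) * L + ln L + 2) \<le> exp (L / 2 - 2) / P"
    using assms by real_asymp
qed

lemma one_plus_power_le_exp:
  fixes s :: real
  assumes "0 \<le> s"
  shows "(1 + s) ^ n \<le> exp (real n * s)"
proof -
  have "(1 + s) ^ n \<le> exp s ^ n"
    using assms exp_ge_add_one_self[of s] by (intro power_mono) auto
  then show ?thesis by (simp add: exp_of_nat_mult)
qed

text \<open>With tilt \<open>s = 1 / N\<close> the extra contraction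
  \<open>(1 + s) ^ (2 * N)\<close> stays below \<open>exp 2\<close> over the whole block, while the
  Chernoff exponent loses only the factor \<open>(N + 1)\<^sup>2\<close>. The last two assumptions
  leave a final threshold of at least \<open>exp (L / 2 - 2) / P\<close> and make the failure
  probability smaller than the main term.\<close>

lemma gallager_mean_decay:
  fixes N :: nat
  assumes "0 < P" "0 < \<alpha>" "\<alpha> < 1" "1 \<le> N" "exp L / P \<le> x\<^sup>2"
    and "2 * real N * ln (1 / \<alpha>) \<le> L / 2"
    and "(real N + 1)\<^sup>2 * (real N * L + real N) \<le> exp (L / 2 - 2) / P"
  shows "gallager_mean P N 1 x \<alpha> \<le> 2 * exp (- real N * (L - (real N + 1) * ln (1 / \<alpha>) - 3))"
proof -
  define l s y where "l = ln (1 / \<alpha>)" and "s = 1 / real N" and "y = exp L / P"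
  have l: "0 < l" using assms by (simp add: l_def)
  have s: "0 < s" "real N * s = 1" "s / (1 + s) = 1 / (real N + 1)"
    using assms(4) by (simp_all add: s_def field_simps)
  have y: "0 < y" using assms(1) by (simp add: y_def)
  have \<alpha>: "\<alpha>\<^sup>2 = exp (- 2 * l)"
  proof -
    have "\<alpha> = exp (- l)" using assms by (simp add: l_def ln_div)
    then show ?thesis by (simp add: power2_eq_square mult_exp_exp)
  qed
  have \<alpha>2: "\<alpha>\<^sup>2 < 1" "0 < \<alpha>\<^sup>2" using l by (simp_all add: \<alpha>)
  define b where "b i = (\<alpha>\<^sup>2 / (1 + s)\<^sup>2) ^ i * y" for i
  have b_pos: "0 < b i" for i using \<alpha>2 s(1) y by (simp add: b_def)
  have b_lower: "exp (- 2 * real i * (l + s)) * y \<le> b i" for i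
  proof -
    have "((1 + s)\<^sup>2) ^ i \<le> exp (2 * real i * s)"
      using one_plus_power_le_exp[of s "2 * i"] s(1) by (simp add: power_mult)
    then have "exp (- 2 * real i * l) / exp (2 * real i * s) \<le> exp (- 2 * real i * l) / ((1 + s)\<^sup>2) ^ i"
      using s(1) by (intro divide_left_mono) auto
    also have "\<dots> = (\<alpha>\<^sup>2 / (1 + s)\<^sup>2) ^ i"
      by (simp add: \<alpha> power_divide exp_of_nat_mult[symmetric] mult_ac)
    finally have "exp (- 2 * real i * l) / exp (2 * real i * s) \<le> (\<alpha>\<^sup>2 / (1 + s)\<^sup>2) ^ i" .
    moreover have "exp (- 2 * real i * l) / exp (2 * real i * s) = exp (- 2 * real i * (l + s))"
      by (simp add: exp_diff[symmetric] algebra_simps)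
    ultimately show ?thesis unfolding b_def using y by (simp add: mult_right_mono)
  qed
  have "(\<Prod>i=1..N. 1 / (1 + P / 2 * b i)) \<le> (\<Prod>i=1..N. exp (ln 2 - L + 2 * real i * (l + s)))"
  proof (rule prod_mono, safe)
    fix i
    have "0 < P / 2 * b i" using assms(1) b_pos by simp
    then show "0 \<le> 1 / (1 + P / 2 * b i)" by simp
    have "1 / (1 + P / 2 * b i) \<le> 1 / (P / 2 * (exp (- 2 * real i * (l + s)) * y))"
    proof (rule divide_left_mono)
      have "P / 2 * (exp (- 2 * real i * (l + s)) * y) \<le> P / 2 * b i"
        using assms(1) b_lower[of i] by (intro mult_left_mono) auto
      then show "P / 2 * (exp (- 2 * real i * (l + s)) * y) \<le> 1 + P / 2 * b i" by linarith
    qed (use assms(1) y \<open>0 < P / 2 * b i\<close> in auto)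
    also have "\<dots> = 2 / exp (L - 2 * real i * (l + s))"
      using assms(1) by (simp add: y_def mult_exp_exp)
    also have "\<dots> = exp (ln 2 - L + 2 * real i * (l + s))"
      by (simp add: exp_diff exp_add)
    finally show "1 / (1 + P / 2 * b i) \<le> exp (ln 2 - L + 2 * real i * (l + s))" .
  qed
  also have "\<dots> = exp (real N * (ln 2 - L) + 2 * (\<Sum>i=1..N. real i) * (l + s))"
    by (simp add: exp_sum[symmetric] sum.distrib sum_distrib_left sum_distrib_right)
  also have "(\<Sum>i=1..N. real i) = real N * (real N + 1) / 2"
    by (induction N) (simp_all add: field_simps)
  \<comment> \<open>The constant 3 covers \<open>N * ln 2\<close> from the halved power at
    \<open>\<rho> = 1\<close> and the N + 1 from the tilt, since
    \<open>N + (N + 1) \<le> 3 * N\<close>.\<close>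
  also have "exp (real N * (ln 2 - L) + 2 * (real N * (real N + 1) / 2) * (l + s))
      \<le> exp (- real N * (L - (real N + 1) * l - 3))"
  proof -
    have "2 * (real N * (real N + 1) / 2) * (l + s) = real N * (real N + 1) * l + (real N + 1) * (real N * s)"
      by (simp add: algebra_simps)
    moreover have "real N * ln 2 \<le> real N * 1" using ln_2_less_1 by (intro mult_left_mono) auto
    moreover have "1 \<le> real N" using assms(4) by simp
    moreover have "- real N * (L - (real N + 1) * l - 3) = - real N * L + real N * (real N + 1) * l + 3 * real N"
      by (simp add: algebra_simps)
    moreover have "real N * (ln 2 - L) = real N * ln 2 - real N * L"
      by (rule right_diff_distrib)
    moreover have "a + b \<le> c" if "b = B + (n + 1) * 1" "D \<le> n * 1" "1 \<le> n" "c = - A + B + 3 * n" "a = D - A"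
      for a b c n A B D :: real
      using that by (simp add: algebra_simps)
    ultimately show ?thesis unfolding s(2) exp_le_cancel_iff mult_minus_left by blast
  qed
  finally have good: "(\<Prod>i=1..N. 1 / (1 + P / 2 * b i)) \<le> exp (- real N * (L - (real N + 1) * l - 3))" .
  have b_N: "(real N + 1)\<^sup>2 * (real N * L + real N) \<le> b N"
  proof -
    have "(real N + 1)\<^sup>2 * (real N * L + real N) \<le> exp (L / 2 - 2) / P" by fact
    also have "\<dots> \<le> exp (- 2 * real N * (l + s) + L) / P"
      using assms(1,6) s(2) by (intro divide_right_mono) (auto simp: algebra_simps l_def)
    also have "\<dots> = exp (- 2 * real N * (l + s)) * y"
      by (simp add: y_def mult_exp_exp)
    also have "\<dots> \<le> b N" by (rule b_lower)
    finally show ?thesis .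
  qed
  \<comment> \<open>Each exponent involves \<open>\<alpha>\<^sup>2 * b i\<close>, which is at least
    \<open>b N\<close>, so the last threshold controls all summands. The additional N in
    \<open>N * L + N\<close> pays for their number through
    \<open>N * exp (- N) \<le> 1\<close>.\<close>
  have "(\<Sum>i<N. exp (- \<alpha>\<^sup>2 * b i * (s / (1 + s))\<^sup>2)) \<le> (\<Sum>i<N. exp (- (real N * L + real N)))"
  proof (rule sum_mono)
    fix i assume "i \<in> {..<N}"
    have q: "0 \<le> \<alpha>\<^sup>2 / (1 + s)\<^sup>2" "\<alpha>\<^sup>2 / (1 + s)\<^sup>2 \<le> \<alpha>\<^sup>2"
      using s(1) \<alpha>2 by (auto simp: divide_le_eq mult_le_cancel_left1 one_le_power)
    then have "(\<alpha>\<^sup>2 / (1 + s)\<^sup>2) ^ N \<le> (\<alpha>\<^sup>2 / (1 + s)\<^sup>2) ^ Suc i"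
      using \<alpha>2 \<open>i \<in> {..<N}\<close> by (intro power_decreasing) auto
    also have "\<dots> \<le> \<alpha>\<^sup>2 * (\<alpha>\<^sup>2 / (1 + s)\<^sup>2) ^ i"
      unfolding power_Suc using q by (intro mult_right_mono) simp_all
    finally have "b N \<le> \<alpha>\<^sup>2 * b i"
      using y mult_right_mono[of "(\<alpha>\<^sup>2 / (1 + s)\<^sup>2) ^ N" "\<alpha>\<^sup>2 * (\<alpha>\<^sup>2 / (1 + s)\<^sup>2) ^ i" y] by (simp add: b_def mult_ac)
    with b_N have "(real N + 1)\<^sup>2 * (real N * L + real N) \<le> \<alpha>\<^sup>2 * b i" by linarith
    then have "real N * L + real N \<le> \<alpha>\<^sup>2 * b i / (real N + 1)\<^sup>2"
      by (subst pos_le_divide_eq) (auto simp: mult_ac)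
    also have "\<dots> = \<alpha>\<^sup>2 * b i * (s / (1 + s))\<^sup>2"
      by (simp add: s(3) power_divide)
    finally show "exp (- \<alpha>\<^sup>2 * b i * (s / (1 + s))\<^sup>2) \<le> exp (- (real N * L + real N))" by simp
  qed
  also have "\<dots> = real N * exp (- real N) * exp (- real N * L)"
    by (simp add: mult_exp_exp)
  also have "real N * exp (- real N) \<le> 1"
  proof -
    have "real N \<le> exp (real N)" using exp_ge_add_one_self[of "real N"] by linarith
    then show ?thesis by (simp add: exp_minus field_simps)
  qed
  also have "1 * exp (- real N * L) \<le> exp (- real N * (L - (real N + 1) * l - 3))"
    using l by (simp add: algebra_simps)
  finally have bad: "(\<Sum>i<N. exp (- \<alpha>\<^sup>2 * b i * (s / (1 + s))\<^sup>2)) \<le> exp (- real N * (L - (real N + 1) * l - 3))"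
    by (simp add: mult_right_mono)
  have "gallager_mean P N 1 x \<alpha> \<le> (\<Prod>i=1..N. 1 / (1 + P / 2 * b i)) + (\<Sum>i<N. exp (- \<alpha>\<^sup>2 * b i * (s / (1 + s))\<^sup>2))"
    unfolding b_def using assms(1,5) \<alpha>2 s(1) y by (intro gallager_mean_upper) (auto simp: y_def)
  with good bad show ?thesis unfolding l_def by linarith
qed

lemma best_throughput_lower:
  assumes "0 < P" "0 < \<alpha>" "\<alpha> < 1" "exp L / P \<le> x\<^sup>2"
    and "0 < L" and L: "1 \<le> ln L" "2 * sqrt (L / 16 * ln L) + 2 + L / 8 \<le> L / 2"
      "(ln L + 3)\<^sup>2 * ((ln L + 2) * L + ln L + 2) \<le> exp (L / 2 - 2) / P"
  shows "L - 2 * sqrt (ln L) * sqrt (ln (inverse \<alpha>)) - 16 * ln (inverse \<alpha>) - 7 \<le> best_throughput P x \<alpha>"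
proof -
  \<comment> \<open>The floor \<open>1 / ln L\<close> keeps the block length
    \<open>sqrt (ln L / l')\<close> below \<open>ln L\<close> when \<alpha> is near 1. If it is
    active, \<open>l' * ln L = 1\<close>, so it costs only an additive 1 in the square root.\<close>
  define l l' where "l = ln (1 / \<alpha>)" and "l' = max l (1 / ln L)"
  have l: "0 < l" using assms by (simp add: l_def)
  have \<alpha>2: "\<alpha>\<^sup>2 < 1" using assms(2,3) by (simp add: power_less_one_iff abs_square_less_1)
  have best_nonneg: "0 \<le> best_throughput P x \<alpha>" by (rule best_throughput_nonneg[OF assms(1) \<alpha>2])
  have "L - 2 * sqrt (l * ln L) - 16 * l - 7 \<le> best_throughput P x \<alpha>"
  \<comment> \<open>For larger l the term \<open>16 * l\<close> exceeds L, and the claim follows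
    from nonnegativity.\<close>
  proof (cases "l \<le> L / 16")
    case False
    moreover have "0 \<le> sqrt (l * ln L)" using l L(1) by simp
    ultimately show ?thesis using best_nonneg by linarith
  next
    case True
    have l': "l \<le> l'" "1 / ln L \<le> l'" "0 < l'" using l by (auto simp: l'_def)
    define r where "r = sqrt (ln L / l')"
    define N where "N = nat \<lceil>r\<rceil>"
    have r: "0 < r" using L(1) l' by (simp add: r_def)
    have "r \<le> real N" "real N < r + 1" using r unfolding N_def by linarith+
    have N: "1 \<le> N" using r \<open>r \<le> real N\<close> by (metis less_one linorder_not_le of_nat_0 order.strict_trans1)
    have rl': "r * l' = sqrt (l' * ln L)" "ln L / r = sqrt (l' * ln L)"
      using l' L(1) by (simp_all add: r_def real_sqrt_divide real_sqrt_mult real_div_sqrt field_simps)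
    have sqrt_l': "sqrt (l' * ln L) \<le> sqrt (l * ln L) + 1"
    proof (cases "l' = l")
      case False
      then have "l' * ln L = 1" using L(1) by (simp add: l'_def max_def split: if_splits)
      then show ?thesis using l L(1) by simp
    qed simp
    have "r \<le> ln L"
    proof -
      have "ln L / l' \<le> ln L * ln L"
        using l'(2,3) L(1) by (simp add: divide_le_eq) (simp add: field_simps)
      then show ?thesis unfolding r_def using L(1) by (metis real_sqrt_le_iff real_sqrt_mult_self abs_of_nonneg order_trans zero_le_one real_sqrt_mult)
    qed
    have Nl: "real N * l \<le> sqrt (l * ln L) + 1 + l"
    proof -
      have "real N * l \<le> (r + 1) * l" using l \<open>real N < r + 1\<close> by (intro mult_right_mono) auto
      also have "\<dots> \<le> r * l' + l" using r l' by (simp add: distrib_right)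
      finally show ?thesis using rl' sqrt_l' by linarith
    qed
    have LN: "ln L / real N \<le> sqrt (l * ln L) + 1"
    proof -
      have "ln L / real N \<le> ln L / r" using \<open>r \<le> real N\<close> r L(1) by (intro divide_left_mono) auto
      then show ?thesis using rl' sqrt_l' by linarith
    qed
    have Nl': "2 * real N * l \<le> L / 2"
    proof -
      have "sqrt (l * ln L) \<le> sqrt (L / 16 * ln L)"
        using True L(1) by (intro real_sqrt_le_mono mult_right_mono) auto
      then show ?thesis using Nl True L(2) by linarith
    qed
    have "(real N + 1)\<^sup>2 * (real N * L + real N) \<le> (ln L + 3)\<^sup>2 * ((ln L + 2) * L + (ln L + 2))"
    proof (rule mult_mono)
      have "real N \<le> ln L + 2" "real N + 1 \<le> ln L + 3"
        using \<open>r \<le> ln L\<close> \<open>real N < r + 1\<close> by linarith+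
      then show "(real N + 1)\<^sup>2 \<le> (ln L + 3)\<^sup>2" "real N * L + real N \<le> (ln L + 2) * L + (ln L + 2)"
        using \<open>0 < L\<close> by (auto intro!: power_mono add_mono mult_right_mono)
    qed (use \<open>0 < L\<close> in auto)
    then have "(real N + 1)\<^sup>2 * (real N * L + real N) \<le> exp (L / 2 - 2) / P"
      using L(3) by (simp add: add.assoc)
    then have F: "gallager_mean P N 1 x \<alpha> \<le> 2 * exp (- real N * (L - (real N + 1) * l - 3))"
      using Nl' assms N unfolding l_def by (intro gallager_mean_decay) auto
    \<comment> \<open>The final backoff \<open>ln L / N\<close> reduces the error bound to
      \<open>2 / L\<close>. As \<open>R \<le> L\<close>, errors cost at most 2; together with the 5
      in \<open>R_lower\<close> (3 from the decay bound, 1 from each of \<open>Nl\<close> and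
      \<open>LN\<close>) this gives the 7.\<close>
    define R where "R = L - (real N + 1) * l - 3 - ln L / real N"
    have R_lower: "L - 2 * sqrt (l * ln L) - 2 * l - 5 \<le> R"
      using Nl LN by (simp add: R_def distrib_right)
    have "R - 2 \<le> best_throughput P x \<alpha>"
    proof (cases "0 \<le> R")
      case False
      then show ?thesis using best_nonneg by linarith
    next
      case True
      have "0 \<le> (real N + 1) * l" "0 \<le> ln L / real N" using l L(1) by simp_all
      then have "R \<le> L" unfolding R_def by linarith
      have "exp (real N * 1 * R) * gallager_mean P N 1 x \<alpha> \<le> exp (real N * 1 * R) * (2 * exp (- real N * (L - (real N + 1) * l - 3)))"
        by (intro mult_left_mono F) simp
      also have "\<dots> = 2 * exp (- (real N * (ln L / real N)))"
        by (simp add: R_def mult_exp_exp algebra_simps)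
      also have "\<dots> = 2 / L" using N \<open>0 < L\<close> by (simp add: exp_minus inverse_eq_divide)
      finally have "exp (real N * 1 * R) * gallager_mean P N 1 x \<alpha> \<le> 2 / L" .
      then have "R * (1 - 2 / L) \<le> R * (1 - exp (real N * 1 * R) * gallager_mean P N 1 x \<alpha>)"
        using True by (intro mult_left_mono) auto
      also have "\<dots> \<le> throughput P x \<alpha> N R"
        by (rule throughput_ge[OF assms(1) \<alpha>2 N True]) simp
      also have "\<dots> \<le> best_throughput P x \<alpha>"
        by (rule throughput_le_best[OF assms(1) \<alpha>2 N True])
      finally have "R * (1 - 2 / L) \<le> best_throughput P x \<alpha>" .
      moreover have "R * (2 / L) \<le> 2" using \<open>R \<le> L\<close> \<open>0 < L\<close> by (simp add: field_simps)
      ultimately show ?thesis by (simp add: right_diff_distrib)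
    qed
    then show ?thesis using R_lower l by linarith
  qed
  then show ?thesis
    by (simp add: l_def real_sqrt_mult inverse_eq_divide mult_ac)
qed


section \<open>The scheduled user\<close>

lemma sets_rayleigh_law [simp, measurable_cong]: "sets rayleigh_law = sets borel"
  and space_rayleigh_law [simp]: "space rayleigh_law = UNIV"
  by (simp_all add: rayleigh_law_def)

lemma nn_integral_rayleigh_law:
  assumes [measurable]: "f \<in> borel_measurable borel"
  shows "(\<integral>\<^sup>+u. f u \<partial>rayleigh_law) = (\<integral>\<^sup>+u. ennreal (indicator {0..} u * (2 * u * exp (- u\<^sup>2))) * f u \<partial>lborel)"
  unfolding rayleigh_law_def by (subst nn_integral_density) (auto intro!: nn_integral_cong simp: indicator_def)

lemma prob_space_rayleigh_law: "prob_space rayleigh_law"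
proof
  have "(\<integral>\<^sup>+u. 1 \<partial>rayleigh_law) = (1 :: ennreal)"
    using nn_integral_gaussian_moment_odd[of 1 0] by (subst nn_integral_rayleigh_law) simp_all
  then show "emeasure rayleigh_law (space rayleigh_law) = 1" by simp
qed

text \<open>Finite because 1/2 is below the Rayleigh rate 1. Summed over the users, it controls the
  mean of the largest power.\<close>

lemma rayleigh_law_exp_moment: "(\<integral>\<^sup>+u. ennreal (exp (u\<^sup>2 / 2)) \<partial>rayleigh_law) = 2"
proof -
  have "(\<integral>\<^sup>+u. ennreal (exp (u\<^sup>2 / 2)) \<partial>rayleigh_law)
      = (\<integral>\<^sup>+u. ennreal (indicator {0..} u * (2 * u * (u\<^sup>2) ^ 0 * exp (- (1 / 2) * u\<^sup>2))) \<partial>lborel)"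
    by (subst nn_integral_rayleigh_law)
       (auto intro!: nn_integral_cong simp: indicator_def ennreal_mult'[symmetric] mult_exp_exp)
  also have "\<dots> = ennreal 2"
    by (subst nn_integral_gaussian_moment_odd) simp_all
  finally show ?thesis by simp
qed

lemma rayleigh_law_tail:
  assumes "0 \<le> y"
  shows "emeasure rayleigh_law {sqrt y..} = ennreal (exp (- y))"
proof -
  have "emeasure rayleigh_law {sqrt y..} = (\<integral>\<^sup>+u. indicator {sqrt y..} u \<partial>rayleigh_law)" by simp
  also have "\<dots> = (\<integral>\<^sup>+u. ennreal (2 * u * exp (- u\<^sup>2)) * indicator {sqrt y..} u \<partial>lborel)"
    using assms order_trans[of 0 "sqrt y"]
    by (subst nn_integral_rayleigh_law) (auto intro!: nn_integral_cong simp: indicator_def)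
  also have "\<dots> = ennreal (0 - (- exp (- (sqrt y)\<^sup>2)))"
  proof (rule nn_integral_FTC_atLeast)
    fix x :: real assume "sqrt y \<le> x"
    show "DERIV (\<lambda>u. - exp (- u\<^sup>2)) x :> 2 * x * exp (- x\<^sup>2)"
      by (auto intro!: derivative_eq_intros)
    have "0 \<le> x" using assms \<open>sqrt y \<le> x\<close> order_trans[of 0 "sqrt y" x] by simp
    then show "0 \<le> 2 * x * exp (- x\<^sup>2)" by simp
  next
    show "((\<lambda>u :: real. - exp (- u\<^sup>2)) \<longlongrightarrow> 0) at_top" by real_asymp
  qed simp
  finally show ?thesis using assms by simp
qed

lemma sets_uniform_law [simp, measurable_cong]: "sets uniform_law = sets borel"
  and space_uniform_law [simp]: "space uniform_law = UNIV"
  by (simp_all add: uniform_law_def)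

lemma prob_space_uniform_law: "prob_space uniform_law"
  unfolding uniform_law_def by (rule prob_space_uniform_measure) simp_all

lemma AE_uniform_law: "AE a in uniform_law. 0 < a \<and> a < 1"
  unfolding uniform_law_def by (subst AE_uniform_measure) auto

text \<open>The antiderivative \<open>x - x * ln x\<close> extends continuously to 0. The value 1
  turns every error proportional to l into a constant.\<close>

lemma has_bochner_integral_ln_inverse:
  "has_bochner_integral uniform_law (\<lambda>a. ln (inverse a)) 1"
proof -
  have deriv: "DERIV (\<lambda>x. x - x * ln x) x :> - ln x" if "ereal 0 < ereal x" "ereal x < ereal 1" for x
    using that by (auto intro!: derivative_eq_intros)
  have cont: "isCont (\<lambda>x. - ln x) x" if "ereal 0 < ereal x" "ereal x < ereal 1" for x :: real
    using that by (intro continuous_intros) auto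
  have nonneg: "AE x in lborel. ereal 0 < ereal x \<longrightarrow> ereal x < ereal 1 \<longrightarrow> 0 \<le> - ln x"
    by simp
  have lim: "(((\<lambda>x. x - x * ln x) \<circ> real_of_ereal) \<longlongrightarrow> 0) (at_right (ereal 0))"
    "(((\<lambda>x. x - x * ln x) \<circ> real_of_ereal) \<longlongrightarrow> 1) (at_left (ereal 1))"
    unfolding ereal_tendsto_simps by real_asymp+
  have "ereal 0 < ereal 1" by simp
  note FTC = interval_integral_FTC_nonneg[OF this deriv cont nonneg lim]
  have E: "einterval (ereal 0) (ereal 1) = {0<..<1::real}" by (auto simp: einterval_def)
  have int: "integrable lborel (\<lambda>x::real. indicator {0<..<1} x * - ln x)"
    using FTC(1) unfolding E set_integrable_def by simp
  have val: "(\<integral>x. indicator {0<..<1} x * - ln x \<partial>lborel) = (1 :: real)"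
    using FTC(2) unfolding interval_lebesgue_integral_def E set_lebesgue_integral_def by simp
  have "(\<integral>\<^sup>+a. ennreal (ln (inverse a)) \<partial>uniform_law) = (\<integral>\<^sup>+a. ennreal (indicator {0<..<1} a * - ln a) \<partial>lborel)"
  proof -
    have "(\<integral>\<^sup>+a. ennreal (ln (inverse a)) \<partial>uniform_law) = (\<integral>\<^sup>+a. ennreal (ln (inverse a)) * indicator {0<..<1} a \<partial>lborel)"
      unfolding uniform_law_def by (subst nn_integral_uniform_measure) (simp_all add: divide_ennreal_def)
    also have "\<dots> = (\<integral>\<^sup>+a. ennreal (indicator {0<..<1} a * - ln a) \<partial>lborel)"
      by (intro nn_integral_cong) (auto simp: indicator_def ln_inverse)
    finally show ?thesis .
  qed
  also have "\<dots> = ennreal 1"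
    using int val by (subst nn_integral_eq_integral) (auto simp: indicator_def)
  finally have "(\<integral>\<^sup>+a. ennreal (ln (inverse a)) \<partial>uniform_law) = ennreal 1" .
  moreover have "AE a in uniform_law. 0 \<le> ln (inverse a)"
    using AE_uniform_law by eventually_elim (simp add: ln_inverse)
  ultimately show ?thesis
    by (intro has_bochner_integral_nn_integral) simp_all
qed

lemma integrable_sqrt_ln_inverse: "integrable uniform_law (\<lambda>a. sqrt (ln (inverse a)))"
proof (rule Bochner_Integration.integrable_bound)
  interpret prob_space uniform_law by (rule prob_space_uniform_law)
  show "integrable uniform_law (\<lambda>a. 1 + ln (inverse a))"
    using has_bochner_integral_ln_inverse by (auto simp: has_bochner_integral_iff)
  show "AE a in uniform_law. norm (sqrt (ln (inverse a))) \<le> norm (1 + ln (inverse a))"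
    using AE_uniform_law
  proof eventually_elim
    fix a :: real assume "0 < a \<and> a < 1"
    then have "0 \<le> ln (inverse a)" by (simp add: ln_inverse)
    then show "norm (sqrt (ln (inverse a))) \<le> norm (1 + ln (inverse a))"
      using arith_geo_mean_sqrt[of 1 "ln (inverse a)"] by simp
  qed
qed simp

text \<open>Strict positivity makes the second-order term diverge, so that a bounded error can be
  expressed as a relative one.\<close>

lemma integral_sqrt_ln_inverse_pos: "0 < (\<integral>a. sqrt (ln (inverse a)) \<partial>uniform_law)"
proof -
  interpret prob_space uniform_law by (rule prob_space_uniform_law)
  have nonneg: "AE a in uniform_law. 0 \<le> sqrt (ln (inverse a))"
    using AE_uniform_law by eventually_elim (simp add: ln_inverse)
  have "(\<integral>a. sqrt (ln (inverse a)) \<partial>uniform_law) \<noteq> 0"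
  proof
    assume "(\<integral>a. sqrt (ln (inverse a)) \<partial>uniform_law) = 0"
    then have "AE a in uniform_law. sqrt (ln (inverse a)) = 0"
      using integral_nonneg_eq_0_iff_AE[OF integrable_sqrt_ln_inverse nonneg] by simp
    with AE_uniform_law have "AE a in uniform_law. False"
      by eventually_elim (simp add: ln_inverse)
    then show False by simp
  qed
  with integral_nonneg_AE[OF nonneg] show ?thesis by linarith
qed

section \<open>Gain and correlation of the selected user\<close>

context
  fixes K :: nat
  assumes K: "1 \<le> K"
begin

lemma selected_user: "selected_user K u \<in> {1..K}" "j \<in> {1..K} \<Longrightarrow> u j \<le> u (selected_user K u)"
proof -
  have "Max (u ` {1..K}) \<in> u ` {1..K}" using K by (intro Max_in) auto
  then obtain k where k: "k \<in> {1..K}" "u k = Max (u ` {1..K})" by force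
  have "is_arg_max u (\<lambda>k. k \<in> {1..K}) k"
    using k by (auto simp: is_arg_max_def not_less)
  then have "is_arg_max u (\<lambda>k. k \<in> {1..K}) (selected_user K u)"
    unfolding selected_user_def arg_max_on_def arg_max_def by (rule someI)
  then show "selected_user K u \<in> {1..K}" "j \<in> {1..K} \<Longrightarrow> u j \<le> u (selected_user K u)"
    by (auto simp: is_arg_max_def not_less)
qed

text \<open>Ties are broken by an arbitrary choice, but the choice depends only on the set of
  maximizers. That set takes finitely many values, each on a measurable event, so no null set has to
  be discarded.\<close>

lemma measurable_selected_user:
  "selected_user K \<in> measurable (\<Pi>\<^sub>M k\<in>{1..K}. rayleigh_law) (count_space {1..K})"
proof (subst measurable_count_space_eq2, simp, safe)
  fix u show "selected_user K u \<in> {1..K}" by (rule selected_user)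
next
  fix a
  let ?M = "\<Pi>\<^sub>M k\<in>{1..K}. rayleigh_law"
  define A where "A u = {k \<in> {1..K}. \<forall>j\<in>{1..K}. u j \<le> u k}" for u :: "nat \<Rightarrow> real"
  have sel: "selected_user K u = (SOME k. k \<in> A u)" for u
    unfolding selected_user_def arg_max_on_def arg_max_def A_def
    by (rule arg_cong[where f = Eps]) (auto simp: is_arg_max_def not_less)
  have meas: "{u \<in> space ?M. A u = S} \<in> sets ?M" if "S \<subseteq> {1..K}" for S
  proof -
    have "{u \<in> space ?M. A u = S} = {u \<in> space ?M. \<forall>k\<in>{1..K}. (k \<in> S \<longleftrightarrow> (\<forall>j\<in>{1..K}. u j \<le> u k))}"
      using that by (auto simp: A_def)
    moreover
    have "(\<lambda>u. u k) \<in> borel_measurable ?M" if "k \<in> {1..K}" for k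
      using measurable_component_singleton[OF that, of "\<lambda>_. rayleigh_law"]
      unfolding measurable_cong_sets[OF refl sets_rayleigh_law] .
    then have "Measurable.pred ?M (\<lambda>u. u j \<le> u k)" if "j \<in> {1..K}" "k \<in> {1..K}" for j k
      using that by (intro borel_measurable_le[folded pred_def])
    then have "Measurable.pred ?M (\<lambda>u. \<forall>k\<in>{1..K}. (k \<in> S \<longleftrightarrow> (\<forall>j\<in>{1..K}. u j \<le> u k)))"
      by (intro pred_intros_countable_bounded(3) pred_intros_logic(6)) simp_all
    ultimately show ?thesis by (simp only: pred_def)
  qed
  have "selected_user K -` {a} \<inter> space ?M = (\<Union>S\<in>{S. S \<subseteq> {1..K} \<and> (SOME k. k \<in> S) = a}. {u \<in> space ?M. A u = S})"
  proof -
    have "A u \<subseteq> {1..K}" for u unfolding A_def by blast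
    then show ?thesis unfolding sel vimage_def by blast
  qed
  also have "\<dots> \<in> sets ?M"
    using meas by (intro sets.finite_UN) auto
  finally show "selected_user K -` {a} \<inter> space ?M \<in> sets ?M" .
qed

lemma prob_space_gains: "prob_space (\<Pi>\<^sub>M k\<in>{1..K}. rayleigh_law)"
  by (rule prob_space_PiM) (rule prob_space_rayleigh_law)

lemma prob_space_correlations: "prob_space (\<Pi>\<^sub>M k\<in>{1..K}. uniform_law)"
  by (rule prob_space_PiM) (rule prob_space_uniform_law)

lemma pair_prob_space_users: "pair_prob_space (\<Pi>\<^sub>M k\<in>{1..K}. rayleigh_law) (\<Pi>\<^sub>M k\<in>{1..K}. uniform_law)"
  using prob_space_gains prob_space_correlations
  by (simp add: pair_prob_space_def pair_sigma_finite_def prob_space_imp_sigma_finite)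

lemma prob_space_users_law: "prob_space (users_law K)"
  unfolding users_law_def using prob_space_gains prob_space_correlations by (rule prob_space_pair)

lemma measurable_gain: "k \<in> {1..K} \<Longrightarrow> (\<lambda>\<omega>. fst \<omega> k) \<in> borel_measurable (users_law K)"
  using measurable_compose[OF measurable_fst measurable_component_singleton[of k "{1..K}" "\<lambda>_. rayleigh_law"]]
  unfolding users_law_def by simp

lemma measurable_correlation: "k \<in> {1..K} \<Longrightarrow> (\<lambda>\<omega>. snd \<omega> k) \<in> borel_measurable (users_law K)"
  using measurable_compose[OF measurable_snd measurable_component_singleton[of k "{1..K}" "\<lambda>_. uniform_law"]]
  unfolding users_law_def by simp

lemma measurable_selected_user_users: "(\<lambda>\<omega>. selected_user K (fst \<omega>)) \<in> measurable (users_law K) (count_space {1..K})"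
  unfolding users_law_def by (rule measurable_compose[OF measurable_fst measurable_selected_user])

lemma measurable_selected_gain: "(\<lambda>\<omega>. fst \<omega> (selected_user K (fst \<omega>))) \<in> borel_measurable (users_law K)"
  by (rule measurable_compose_countable'[OF measurable_gain measurable_selected_user_users]) auto

lemma measurable_selected_correlation: "(\<lambda>\<omega>. snd \<omega> (selected_user K (fst \<omega>))) \<in> borel_measurable (users_law K)"
  by (rule measurable_compose_countable'[OF measurable_correlation measurable_selected_user_users]) auto

text \<open>The selection depends on the gains only, so the selected correlation coefficient is still uniform.\<close>

lemma distr_selected_correlation: "distr (users_law K) borel (\<lambda>\<omega>. snd \<omega> (selected_user K (fst \<omega>))) = uniform_law"
proof (rule measure_eqI)
  interpret pair_prob_space "\<Pi>\<^sub>M k\<in>{1..K}. rayleigh_law" "\<Pi>\<^sub>M k\<in>{1..K}. uniform_law"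
    by (rule pair_prob_space_users)
  fix S assume "S \<in> sets (distr (users_law K) borel (\<lambda>\<omega>. snd \<omega> (selected_user K (fst \<omega>))))"
  then have S: "S \<in> sets borel" by simp
  let ?T = "(\<lambda>\<omega>. snd \<omega> (selected_user K (fst \<omega>))) -` S \<inter> space (users_law K)"
  have "emeasure (distr (users_law K) borel (\<lambda>\<omega>. snd \<omega> (selected_user K (fst \<omega>)))) S = emeasure (users_law K) ?T"
    by (rule emeasure_distr[OF measurable_selected_correlation S])
  also have "\<dots> = (\<integral>\<^sup>+u. emeasure (\<Pi>\<^sub>M k\<in>{1..K}. uniform_law) (Pair u -` ?T) \<partial>(\<Pi>\<^sub>M k\<in>{1..K}. rayleigh_law))"
    using measurable_sets[OF measurable_selected_correlation S] unfolding users_law_def by (rule M2.emeasure_pair_measure_alt)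
  also have "\<dots> = (\<integral>\<^sup>+u. emeasure uniform_law S \<partial>(\<Pi>\<^sub>M k\<in>{1..K}. rayleigh_law))"
  proof (rule nn_integral_cong)
    fix u assume u: "u \<in> space (\<Pi>\<^sub>M k\<in>{1..K}. rayleigh_law)"
    have k: "selected_user K u \<in> {1..K}" by (rule selected_user)
    have "Pair u -` ?T = (\<lambda>\<omega>. \<omega> (selected_user K u)) -` S \<inter> space (\<Pi>\<^sub>M k\<in>{1..K}. uniform_law)"
      using u by (auto simp: users_law_def space_pair_measure)
    also have "emeasure (\<Pi>\<^sub>M k\<in>{1..K}. uniform_law) \<dots>
        = emeasure (distr (\<Pi>\<^sub>M k\<in>{1..K}. uniform_law) uniform_law (\<lambda>\<omega>. \<omega> (selected_user K u))) S"
      using S measurable_component_singleton[OF k, of "\<lambda>_. uniform_law"] by (subst emeasure_distr) auto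
    also have "\<dots> = emeasure uniform_law S"
      using k by (subst distr_PiM_component) (auto intro: prob_space_uniform_law)
    finally show "emeasure (\<Pi>\<^sub>M k\<in>{1..K}. uniform_law) (Pair u -` ?T) = emeasure uniform_law S" .
  qed
  also have "\<dots> = emeasure uniform_law S"
    using M1.emeasure_space_1 by simp
  finally show "emeasure (distr (users_law K) borel (\<lambda>\<omega>. snd \<omega> (selected_user K (fst \<omega>)))) S = emeasure uniform_law S" .
qed simp

lemma has_bochner_integral_selected_correlation:
  assumes "has_bochner_integral uniform_law f (m :: real)"
  shows "has_bochner_integral (users_law K) (\<lambda>\<omega>. f (snd \<omega> (selected_user K (fst \<omega>)))) m"
proof -
  have f: "f \<in> borel_measurable borel"
    using assms by (auto simp: has_bochner_integral_iff dest: borel_measurable_integrable)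
  show ?thesis
    using assms integrable_distr_eq[OF measurable_selected_correlation f] integral_distr[OF measurable_selected_correlation f]
    unfolding distr_selected_correlation by (simp add: has_bochner_integral_iff)
qed

lemma AE_selected_correlation: "AE \<omega> in users_law K. 0 < snd \<omega> (selected_user K (fst \<omega>)) \<and> snd \<omega> (selected_user K (fst \<omega>)) < 1"
  using AE_uniform_law AE_distrD[OF measurable_selected_correlation, of "\<lambda>a. 0 < a \<and> a < 1"]
  unfolding distr_selected_correlation by simp

lemma nn_integral_users_fst:
  assumes "f \<in> borel_measurable (\<Pi>\<^sub>M k\<in>{1..K}. rayleigh_law)"
  shows "(\<integral>\<^sup>+\<omega>. f (fst \<omega>) \<partial>users_law K) = (\<integral>\<^sup>+u. f u \<partial>(\<Pi>\<^sub>M k\<in>{1..K}. rayleigh_law))"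
proof -
  interpret pair_prob_space "\<Pi>\<^sub>M k\<in>{1..K}. rayleigh_law" "\<Pi>\<^sub>M k\<in>{1..K}. uniform_law"
    by (rule pair_prob_space_users)
  show ?thesis
    unfolding users_law_def
    using assms M2.emeasure_space_1 by (subst M2.nn_integral_fst[symmetric]) simp_all
qed

lemma gain_exp_moment:
  assumes "k \<in> {1..K}"
  shows "has_bochner_integral (users_law K) (\<lambda>\<omega>. exp ((fst \<omega> k)\<^sup>2 / 2)) 2"
proof -
  have comp: "(\<lambda>u. u k) \<in> measurable (\<Pi>\<^sub>M k\<in>{1..K}. rayleigh_law) rayleigh_law"
    using measurable_component_singleton[OF assms, of "\<lambda>_. rayleigh_law"] by simp
  have "(\<integral>\<^sup>+\<omega>. ennreal (exp ((fst \<omega> k)\<^sup>2 / 2)) \<partial>users_law K)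
      = (\<integral>\<^sup>+u. ennreal (exp ((u k)\<^sup>2 / 2)) \<partial>(\<Pi>\<^sub>M k\<in>{1..K}. rayleigh_law))"
    by (rule nn_integral_users_fst) (rule measurable_compose[OF comp], simp)
  also have "\<dots> = (\<integral>\<^sup>+u. ennreal (exp (u\<^sup>2 / 2)) \<partial>distr (\<Pi>\<^sub>M k\<in>{1..K}. rayleigh_law) rayleigh_law (\<lambda>u. u k))"
    using comp by (subst nn_integral_distr) simp_all
  also have "\<dots> = 2"
    using assms by (subst distr_PiM_component) (auto intro: prob_space_rayleigh_law rayleigh_law_exp_moment)
  finally show ?thesis
    using measurable_gain[OF assms] by (intro has_bochner_integral_nn_integral) simp_all
qed

text \<open>A small maximum forces all K independent gains below \<open>sqrt y\<close>, and
  \<open>1 - t \<le> exp (- t)\<close> turns the K-th power into an exponential. At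
  \<open>y = ln K / 2\<close> the bound is \<open>exp (- sqrt K)\<close>.\<close>

lemma prob_selected_gain_small:
  assumes "0 \<le> y"
  shows "measure (users_law K) {\<omega> \<in> space (users_law K). (fst \<omega> (selected_user K (fst \<omega>)))\<^sup>2 < y} \<le> exp (- real K * exp (- y))"
proof -
  interpret U: prob_space "users_law K" by (rule prob_space_users_law)
  interpret R: prob_space rayleigh_law by (rule prob_space_rayleigh_law)
  let ?G = "\<Pi>\<^sub>M k\<in>{1..K}. rayleigh_law"
  let ?B = "{\<omega> \<in> space (users_law K). (fst \<omega> (selected_user K (fst \<omega>)))\<^sup>2 < y}"
  define C where "C = PiE {1..K} (\<lambda>_. {..<sqrt y})"
  have C: "C \<in> sets ?G" unfolding C_def by (rule sets_PiM_I_finite) auto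
  have tail: "measure rayleigh_law {..<sqrt y} = 1 - exp (- y)"
  proof -
    have "measure rayleigh_law {sqrt y..} = exp (- y)"
      using rayleigh_law_tail[OF assms] by (simp add: measure_def)
    moreover have "{..<sqrt y} = space rayleigh_law - {sqrt y..}" by auto
    ultimately show ?thesis using R.prob_compl[of "{sqrt y..}"] by simp
  qed
  have "indicator ?B \<omega> \<le> (indicator C (fst \<omega>) :: ennreal)" if "\<omega> \<in> space (users_law K)" for \<omega>
  proof (cases "\<omega> \<in> ?B")
    case True
    then have "fst \<omega> (selected_user K (fst \<omega>)) < sqrt y" by (simp add: real_less_rsqrt)
    then have "fst \<omega> j < sqrt y" if "j \<in> {1..K}" for j
      using selected_user(2)[OF that, of "fst \<omega>"] by linarith
    moreover have "fst \<omega> \<in> space ?G" using that by (auto simp: users_law_def space_pair_measure)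
    ultimately have "fst \<omega> \<in> C" by (auto simp: C_def space_PiM PiE_def)
    then show ?thesis by (simp add: indicator_def)
  qed simp
  then have "(\<integral>\<^sup>+\<omega>. indicator ?B \<omega> \<partial>users_law K) \<le> (\<integral>\<^sup>+\<omega>. indicator C (fst \<omega>) \<partial>users_law K)"
    by (rule nn_integral_mono)
  also have "\<dots> = (\<integral>\<^sup>+u. indicator C u \<partial>?G)"
    using C by (intro nn_integral_users_fst) simp
  also have "\<dots> = emeasure ?G C" using C by simp
  also have "\<dots> = (\<Prod>k\<in>{1..K}. emeasure rayleigh_law {..<sqrt y})"
  proof -
    interpret product_prob_space "\<lambda>_. rayleigh_law" "{1..K}" by standard
    show ?thesis unfolding C_def by (rule emeasure_PiM) auto
  qed
  also have "\<dots> = ennreal ((1 - exp (- y)) ^ K)"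
    using assms by (simp add: R.emeasure_eq_measure tail ennreal_power)
  also have "\<dots> \<le> ennreal (exp (- real K * exp (- y)))"
  proof (rule ennreal_leI)
    have "(1 - exp (- y)) ^ K \<le> exp (- exp (- y)) ^ K"
      using assms exp_ge_add_one_self[of "- exp (- y)"] by (intro power_mono) auto
    then show "(1 - exp (- y)) ^ K \<le> exp (- real K * exp (- y))"
      by (simp add: exp_of_nat_mult[symmetric])
  qed
  finally have "emeasure (users_law K) ?B \<le> ennreal (exp (- real K * exp (- y)))"
    using measurable_selected_gain by simp
  then show ?thesis by (simp add: U.emeasure_eq_measure)
qed

end


section \<open>Asymptotics\<close>

definition selected_throughput :: "real \<Rightarrow> nat \<Rightarrow> (nat \<Rightarrow> real) \<times> (nat \<Rightarrow> real) \<Rightarrow> real" where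
  "selected_throughput P K \<omega> = best_throughput P (fst \<omega> (selected_user K (fst \<omega>))) (snd \<omega> (selected_user K (fst \<omega>)))"

lemma strategy2_throughput_eq: "strategy2_throughput P K = (\<integral>\<omega>. selected_throughput P K \<omega> \<partial>users_law K)"
  unfolding strategy2_throughput_def selected_throughput_def best_throughput_def by (simp add: case_prod_beta')

lemma AE_selected_throughput_nonneg:
  assumes "0 < P" "1 \<le> K"
  shows "AE \<omega> in users_law K. 0 \<le> selected_throughput P K \<omega>"
  using AE_selected_correlation[OF assms(2)]
proof eventually_elim
  fix \<omega> :: "(nat \<Rightarrow> real) \<times> (nat \<Rightarrow> real)"
  assume "0 < snd \<omega> (selected_user K (fst \<omega>)) \<and> snd \<omega> (selected_user K (fst \<omega>)) < 1"
  then show "0 \<le> selected_throughput P K \<omega>"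
    unfolding selected_throughput_def using assms(1)
    by (intro best_throughput_nonneg) (auto simp: power_less_one_iff abs_square_less_1)
qed

lemma selected_throughput_upper:
  assumes "0 < P" "1 \<le> K" "1 \<le> ln (real K)" "2 \<le> ln (ln (real K))"
  shows "integrable (users_law K) (selected_throughput P K)"
    and "strategy2_throughput P K \<le> ln (2 * (1 + P)) + ln (ln (real K)) + 8
      - 2 * sqrt (ln (ln (ln (real K)) / 2)) * (\<integral>\<alpha>. sqrt (ln (inverse \<alpha>)) \<partial>uniform_law)"
proof -
  define Y s x a where "Y = ln (ln (real K))" and "s = (\<integral>\<alpha>. sqrt (ln (inverse \<alpha>)) \<partial>uniform_law)"
    and "x \<omega> = fst \<omega> (selected_user K (fst \<omega>))" and "a \<omega> = snd \<omega> (selected_user K (fst \<omega>))"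
    for \<omega> :: "(nat \<Rightarrow> real) \<times> (nat \<Rightarrow> real)"
  have expY: "exp Y = ln (real K)" using assms(3) by (simp add: Y_def)
  define U where "U \<omega> = (ln (2 * (1 + P)) + Y) + (2 + 2 / (real K * ln (real K)) * (\<Sum>k=1..K. exp ((fst \<omega> k)\<^sup>2 / 2)))
      - 2 * sqrt (ln (Y / 2)) * sqrt (ln (inverse (a \<omega>))) + 2 * ln (inverse (a \<omega>))" for \<omega>
  interpret prob_space "users_law K" by (rule prob_space_users_law[OF assms(2)])
  have const: "has_bochner_integral (users_law K) (\<lambda>_. c) c" for c :: real
    by (simp add: has_bochner_integral_iff prob_space)
  have sqrt_l: "has_bochner_integral uniform_law (\<lambda>a. sqrt (ln (inverse a))) s"
    using integrable_sqrt_ln_inverse by (simp add: has_bochner_integral_iff s_def)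
  have U: "has_bochner_integral (users_law K) U ((ln (2 * (1 + P)) + Y) + (2 + 2 / (real K * ln (real K)) * (\<Sum>k=1..K. 2))
      - 2 * sqrt (ln (Y / 2)) * s + 2 * 1)"
    unfolding U_def a_def
    by (intro has_bochner_integral_add has_bochner_integral_diff has_bochner_integral_mult_right has_bochner_integral_sum
        const gain_exp_moment[OF assms(2)] has_bochner_integral_selected_correlation[OF assms(2) sqrt_l]
        has_bochner_integral_selected_correlation[OF assms(2) has_bochner_integral_ln_inverse])
  \<comment> \<open>Applying \<open>1 + t \<le> exp t\<close> to \<open>x\<^sup>2 / 2 - ln K\<close>
    and replacing the maximum by a sum over users bounds the power by an integrable expression with
    mean of order \<open>ln K\<close>, the scale of \<open>exp Y\<close>.\<close>
  have gain: "(x \<omega>)\<^sup>2 / ln (real K) \<le> 2 + 2 / (real K * ln (real K)) * (\<Sum>k=1..K. exp ((fst \<omega> k)\<^sup>2 / 2))" for \<omega>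
  proof -
    have "exp ((x \<omega>)\<^sup>2 / 2) \<le> (\<Sum>k=1..K. exp ((fst \<omega> k)\<^sup>2 / 2))"
      unfolding x_def using selected_user(1)[OF assms(2), of "fst \<omega>"]
      by (intro member_le_sum[where f = "\<lambda>k. exp ((fst \<omega> k)\<^sup>2 / 2)"]) auto
    then have "exp ((x \<omega>)\<^sup>2 / 2) / real K \<le> (\<Sum>k=1..K. exp ((fst \<omega> k)\<^sup>2 / 2)) / real K"
      by (rule divide_right_mono) simp
    moreover have "1 + ((x \<omega>)\<^sup>2 / 2 - ln (real K)) \<le> exp ((x \<omega>)\<^sup>2 / 2) / real K"
      using exp_ge_add_one_self[of "(x \<omega>)\<^sup>2 / 2 - ln (real K)"] assms(2) by (simp add: exp_diff)
    ultimately have "(x \<omega>)\<^sup>2 \<le> 2 * ln (real K) + 2 * ((\<Sum>k=1..K. exp ((fst \<omega> k)\<^sup>2 / 2)) / real K)"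
      by linarith
    then have "(x \<omega>)\<^sup>2 / ln (real K) \<le> (2 * ln (real K) + 2 * ((\<Sum>k=1..K. exp ((fst \<omega> k)\<^sup>2 / 2)) / real K)) / ln (real K)"
      using assms(3) by (intro divide_right_mono) auto
    also have "\<dots> = 2 + 2 / (real K * ln (real K)) * (\<Sum>k=1..K. exp ((fst \<omega> k)\<^sup>2 / 2))"
      using assms(3) by (simp add: add_divide_distrib)
    finally show ?thesis .
  qed
  have le_U: "AE \<omega> in users_law K. selected_throughput P K \<omega> \<le> U \<omega>"
    using AE_selected_correlation[OF assms(2)]
  proof eventually_elim
    fix \<omega> :: "(nat \<Rightarrow> real) \<times> (nat \<Rightarrow> real)"
    assume "0 < snd \<omega> (selected_user K (fst \<omega>)) \<and> snd \<omega> (selected_user K (fst \<omega>)) < 1"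
    then have "selected_throughput P K \<omega> \<le> ln (2 * (1 + P)) + Y + (x \<omega>)\<^sup>2 / exp Y
        - 2 * sqrt (ln (Y / 2)) * sqrt (ln (inverse (a \<omega>))) + 2 * ln (inverse (a \<omega>))"
      unfolding selected_throughput_def x_def a_def using assms(1,4)
      by (intro best_throughput_upper) (auto simp: Y_def)
    then show "selected_throughput P K \<omega> \<le> U \<omega>"
      using gain[of \<omega>] unfolding U_def expY by linarith
  qed
  have meas: "selected_throughput P K \<in> borel_measurable (users_law K)"
    using measurable_compose[OF measurable_Pair[OF measurable_selected_gain[OF assms(2)] measurable_selected_correlation[OF assms(2)]]
        borel_measurable_best_throughput[OF assms(1)]]
    unfolding selected_throughput_def[abs_def] by simp
  have int: "integrable (users_law K) U" using U by (simp add: has_bochner_integral_iff)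
  show *: "integrable (users_law K) (selected_throughput P K)"
  proof (rule Bochner_Integration.integrable_bound[OF int meas])
    show "AE \<omega> in users_law K. norm (selected_throughput P K \<omega>) \<le> norm (U \<omega>)"
      using le_U AE_selected_throughput_nonneg[OF assms(1,2)] by eventually_elim simp
  qed
  have "strategy2_throughput P K \<le> (\<integral>\<omega>. U \<omega> \<partial>users_law K)"
    unfolding strategy2_throughput_eq by (rule integral_mono_AE[OF * int le_U])
  also have "\<dots> = (ln (2 * (1 + P)) + Y) + (2 + 2 / (real K * ln (real K)) * (\<Sum>k=1..K. 2)) - 2 * sqrt (ln (Y / 2)) * s + 2 * 1"
    using U by (simp add: has_bochner_integral_iff)
  also have "2 / (real K * ln (real K)) * (\<Sum>k=1..K. 2) = 4 / ln (real K)"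
    using assms(2) by simp
  \<comment> \<open>The 8 collects 2 and \<open>4 / ln K \<le> 4\<close> from the gain excess, and 2
    from twice the mean of l.\<close>
  also have "(ln (2 * (1 + P)) + Y) + (2 + 4 / ln (real K)) - 2 * sqrt (ln (Y / 2)) * s + 2 * 1
      \<le> ln (2 * (1 + P)) + Y + 8 - 2 * sqrt (ln (Y / 2)) * s"
    using assms(3) by (simp add: divide_le_eq)
  finally show "strategy2_throughput P K \<le> ln (2 * (1 + P)) + ln (ln (real K)) + 8
      - 2 * sqrt (ln (ln (ln (real K)) / 2)) * (\<integral>\<alpha>. sqrt (ln (inverse \<alpha>)) \<partial>uniform_law)"
    unfolding Y_def s_def .
qed

text \<open>The choice of L means \<open>exp L / P = ln K / 2\<close>: half the typical maximal
  power, so that outage is extremely rare while L changes only by a constant. The loss 24 is 16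
  times the mean of l, the 7 of the single-user bound, and 1 for outage.\<close>

lemma strategy2_throughput_lower:
  assumes "0 < P" "1 \<le> K" "1 \<le> ln (real K)" "2 \<le> ln (ln (real K))"
    and L_def: "L = ln (P * ln (real K) / 2)"
    and L: "0 < L" "1 \<le> ln L" "2 * sqrt (L / 16 * ln L) + 2 + L / 8 \<le> L / 2"
      "(ln L + 3)\<^sup>2 * ((ln L + 2) * L + ln L + 2) \<le> exp (L / 2 - 2) / P"
    and outage: "L * exp (- real K * exp (- (ln (real K) / 2))) \<le> 1"
  shows "L - 24 - 2 * sqrt (ln L) * (\<integral>\<alpha>. sqrt (ln (inverse \<alpha>)) \<partial>uniform_law) \<le> strategy2_throughput P K"
proof -
  define s a where "s = (\<integral>\<alpha>. sqrt (ln (inverse \<alpha>)) \<partial>uniform_law)" and "a \<omega> = snd \<omega> (selected_user K (fst \<omega>))"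
    for \<omega> :: "(nat \<Rightarrow> real) \<times> (nat \<Rightarrow> real)"
  define B where "B = {\<omega> \<in> space (users_law K). (fst \<omega> (selected_user K (fst \<omega>)))\<^sup>2 < ln (real K) / 2}"
  interpret prob_space "users_law K" by (rule prob_space_users_law[OF assms(2)])
  have expL: "exp L / P = ln (real K) / 2" using assms(1,3) by (simp add: L_def)
  have B [measurable]: "B \<in> sets (users_law K)"
    unfolding B_def using measurable_selected_gain[OF assms(2)] by measurable
  have prob_B: "prob B \<le> exp (- real K * exp (- (ln (real K) / 2)))"
    unfolding B_def using assms(3) by (intro prob_selected_gain_small[OF assms(2)]) auto
  have const: "has_bochner_integral (users_law K) (\<lambda>_. c) c" for c :: real
    by (simp add: has_bochner_integral_iff prob_space)
  have ind: "has_bochner_integral (users_law K) (indicator B) (prob B)"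
    by (rule has_bochner_integral_real_indicator) (simp_all add: less_top[symmetric])
  have sqrt_l: "has_bochner_integral uniform_law (\<lambda>a. sqrt (ln (inverse a))) s"
    using integrable_sqrt_ln_inverse by (simp add: has_bochner_integral_iff s_def)
  \<comment> \<open>The main term is erased on the outage event, where W is negative and only
    nonnegativity of the throughput is used.\<close>
  define W where "W \<omega> = L * (1 - indicator B \<omega>) - 2 * sqrt (ln L) * sqrt (ln (inverse (a \<omega>))) - 16 * ln (inverse (a \<omega>)) - 7" for \<omega>
  have W: "has_bochner_integral (users_law K) W (L * (1 - prob B) - 2 * sqrt (ln L) * s - 16 * 1 - 7)"
    unfolding W_def a_def
    by (intro has_bochner_integral_diff has_bochner_integral_mult_right const ind
        has_bochner_integral_selected_correlation[OF assms(2) sqrt_l]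
        has_bochner_integral_selected_correlation[OF assms(2) has_bochner_integral_ln_inverse])
  have W_le: "AE \<omega> in users_law K. W \<omega> \<le> selected_throughput P K \<omega>"
    using AE_selected_correlation[OF assms(2)] AE_selected_throughput_nonneg[OF assms(1,2)] AE_space
  proof eventually_elim
    fix \<omega> :: "(nat \<Rightarrow> real) \<times> (nat \<Rightarrow> real)"
    assume \<omega>: "0 < snd \<omega> (selected_user K (fst \<omega>)) \<and> snd \<omega> (selected_user K (fst \<omega>)) < 1"
      "0 \<le> selected_throughput P K \<omega>" "\<omega> \<in> space (users_law K)"
    have l: "0 \<le> ln (inverse (a \<omega>))" using \<omega>(1) by (simp add: a_def ln_inverse)
    show "W \<omega> \<le> selected_throughput P K \<omega>"
    proof (cases "\<omega> \<in> B")
      case True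
      have "0 \<le> 2 * sqrt (ln L) * sqrt (ln (inverse (a \<omega>)))" using l L(2) by simp
      then show ?thesis using True \<omega>(2) l by (simp add: W_def)
    next
      case False
      then have "exp L / P \<le> (fst \<omega> (selected_user K (fst \<omega>)))\<^sup>2"
        using \<omega>(3) unfolding B_def expL by (simp add: not_less)
      then have "L - 2 * sqrt (ln L) * sqrt (ln (inverse (a \<omega>))) - 16 * ln (inverse (a \<omega>)) - 7 \<le> selected_throughput P K \<omega>"
        unfolding selected_throughput_def a_def using assms(1) \<omega>(1) L by (intro best_throughput_lower) auto
      then show ?thesis using False by (simp add: W_def)
    qed
  qed
  have "(\<integral>\<omega>. W \<omega> \<partial>users_law K) \<le> strategy2_throughput P K"
    unfolding strategy2_throughput_eq using W W_le selected_throughput_upper(1)[OF assms(1-4)]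
    by (intro integral_mono_AE) (auto simp: has_bochner_integral_iff)
  moreover have "(\<integral>\<omega>. W \<omega> \<partial>users_law K) = L * (1 - prob B) - 2 * sqrt (ln L) * s - 16 * 1 - 7"
    using W by (simp add: has_bochner_integral_iff)
  moreover have "L * prob B \<le> 1"
    using mult_left_mono[OF prob_B, of L] L(1) outage by linarith
  ultimately show ?thesis
    unfolding s_def by (simp add: right_diff_distrib)
qed

lemma strategy2_throughput_expansion:
  assumes "0 < P"
  defines "s \<equiv> (\<integral>\<alpha>. sqrt (ln (inverse \<alpha>)) \<partial>uniform_law)"
  defines "L \<equiv> \<lambda>K. ln (P * ln (real K) / 2)"
  shows "\<exists>C. \<forall>\<^sub>F K in sequentially. \<bar>strategy2_throughput P K - (L K - 2 * s * sqrt (ln (L K)))\<bar> \<le> C"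
proof
  define C where "C = \<bar>ln (2 * (1 + P)) - ln (P / 2)\<bar> + 24 + 2 * s"
  have s: "0 < s" unfolding s_def by (rule integral_sqrt_ln_inverse_pos)
  have lim: "filterlim L at_top sequentially" unfolding L_def using assms(1) by real_asymp
  have ev: "\<forall>\<^sub>F K in sequentially. 1 \<le> K" "\<forall>\<^sub>F K in sequentially. 1 \<le> ln (real K)"
    "\<forall>\<^sub>F K in sequentially. 2 \<le> ln (ln (real K))"
    by real_asymp+
  have outage: "\<forall>\<^sub>F K in sequentially. L K * exp (- real K * exp (- (ln (real K) / 2))) \<le> 1"
    unfolding L_def using assms(1) by real_asymp
  \<comment> \<open>The converse comes with \<open>ln (Y / 2)\<close>, where
    \<open>Y = ln (ln K)\<close>, and achievability with \<open>ln L\<close>. Since L and Y differ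
    by a constant, the square roots differ by a vanishing amount.\<close>
  have gap: "\<forall>\<^sub>F K in sequentially. sqrt (ln (L K)) \<le> sqrt (ln (ln (ln (real K)) / 2)) + 1"
    unfolding L_def using assms(1) by real_asymp
  from ev eventually_compose_filterlim[OF achievability_conditions[OF assms(1)] lim] outage gap
  show "\<forall>\<^sub>F K in sequentially. \<bar>strategy2_throughput P K - (L K - 2 * s * sqrt (ln (L K)))\<bar> \<le> C"
  proof eventually_elim
    case (elim K)
    have "L K - 24 - 2 * sqrt (ln (L K)) * s \<le> strategy2_throughput P K"
      unfolding s_def using elim assms(1) by (intro strategy2_throughput_lower) (auto simp: L_def)
    moreover have "strategy2_throughput P K \<le> ln (2 * (1 + P)) + ln (ln (real K)) + 8 - 2 * sqrt (ln (ln (ln (real K)) / 2)) * s"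
      unfolding s_def using elim assms(1) by (intro selected_throughput_upper(2)) auto
    moreover have "ln (ln (real K)) = L K - ln (P / 2)"
    proof -
      have "0 < P / 2" "0 < ln (real K)" using assms(1) elim(2) by linarith+
      then have "ln (P / 2 * ln (real K)) = ln (P / 2) + ln (ln (real K))" by (simp only: ln_mult_pos)
      then show ?thesis by (simp add: L_def)
    qed
    moreover have "s * sqrt (ln (L K)) \<le> s * (sqrt (ln (ln (ln (real K)) / 2)) + 1)"
      using elim s by (intro mult_left_mono) auto
    moreover have "2 * sqrt x * s = 2 * (s * sqrt x)" "2 * s * sqrt x = 2 * (s * sqrt x)" for x
      by simp_all
    moreover have "s * (sqrt (ln (ln (ln (real K)) / 2)) + 1) = s * sqrt (ln (ln (ln (real K)) / 2)) + s"
      by (simp add: distrib_left)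
    ultimately show ?case
      using s unfolding C_def abs_le_iff by (smt (verit))
  qed
qed

theorem theorem3:
  fixes P :: real
  assumes "P > 0"
  shows "\<exists>\<epsilon> :: nat \<Rightarrow> real. \<epsilon> \<in> o(\<lambda>_. 1) \<and>
    (\<forall>\<^sub>F K in sequentially.
       strategy2_throughput P K =
         ln (P * ln (real K) / 2)
         - 2 * (1 + \<epsilon> K) * (\<integral>\<alpha>. sqrt (ln (inverse \<alpha>)) \<partial>uniform_law)
             * sqrt (ln (ln (P * ln (real K) / 2))))"
proof -
  define s where "s = (\<integral>\<alpha>. sqrt (ln (inverse \<alpha>)) \<partial>uniform_law)"
  define L where "L K = ln (P * ln (real K) / 2)" for K :: nat
  define D where "D K = 2 * s * sqrt (ln (L K))" for K
  \<comment> \<open>The value that solves the claimed identity whenever \<open>D K\<close> is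
    nonzero; its size is the bounded error of the expansion divided by the diverging
    \<open>D K\<close>.\<close>
  define \<epsilon> where "\<epsilon> K = (L K - strategy2_throughput P K) / D K - 1" for K
  have s: "0 < s" unfolding s_def by (rule integral_sqrt_ln_inverse_pos)
  obtain C where C: "\<forall>\<^sub>F K in sequentially. \<bar>strategy2_throughput P K - (L K - D K)\<bar> \<le> C"
    using strategy2_throughput_expansion[OF assms] unfolding L_def D_def s_def by blast
  have "filterlim (\<lambda>K. sqrt (ln (L K))) at_top sequentially"
    unfolding L_def using assms by real_asymp
  then have D: "filterlim D at_top sequentially"
    unfolding D_def using s by (intro filterlim_tendsto_pos_mult_at_top[OF tendsto_const]) auto
  have D_pos: "\<forall>\<^sub>F K in sequentially. 0 < D K"
    using D by (simp add: filterlim_at_top_dense)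
  have "\<forall>\<^sub>F K in sequentially. norm (\<epsilon> K) \<le> C / D K"
    using C D_pos
  proof eventually_elim
    case (elim K)
    have "\<epsilon> K = - (strategy2_throughput P K - (L K - D K)) / D K"
      using elim by (simp add: \<epsilon>_def field_simps)
    then show ?case
      using elim by (simp add: divide_right_mono)
  qed
  then have "\<epsilon> \<longlonglongrightarrow> 0"
    by (rule Lim_null_comparison) (rule tendsto_divide_0[OF tendsto_const filterlim_at_top_imp_at_infinity[OF D]])
  then have "\<epsilon> \<in> o(\<lambda>_. 1)"
    by (intro smalloI_tendsto) auto
  moreover have "\<forall>\<^sub>F K in sequentially. strategy2_throughput P K = L K - 2 * (1 + \<epsilon> K) * s * sqrt (ln (L K))"
    using D_pos
  proof eventually_elim
    case (elim K)
    have "2 * (1 + \<epsilon> K) * s * sqrt (ln (L K)) = (1 + \<epsilon> K) * D K" by (simp add: D_def)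
    also have "\<dots> = L K - strategy2_throughput P K" using elim by (simp add: \<epsilon>_def)
    finally show ?case by simp
  qed
  ultimately show ?thesis unfolding L_def s_def by blast
qed

end
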